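(* In the setting of the context, let $\beta^{(k)}=\|P^{(k)}H^{-1/2}A^TAH^{-1/2}(I-P^{(k)})\|$, where $P^{(k)}$ is the orthogonal projector onto $\mathrm{span}\{H^{1/2}\hat X^{(k)}\}$. Assume every generalized singular value $\sigma=c/s$ of $(A,B)$ with $c\in[c_{\min},c_{\max}]$ is simple, and define $\delta_i^{(k)}=\min_{j\ne i}|c_i^2-(\hat c_j^{(k)})^2|$, $i=1,\dots,n_{gv}$. Then for $i=1,\dots,n_{gv}$, $$\sin\angle(\hat x_i^{(k)},x_i)_H\le\sqrt{1+\frac{(\beta^{(k)})^2}{(\delta_i^{(k)})^2}}\Bigl(\frac{\gamma_{p+1}}{\gamma_i}\Bigr)^k\|E^{(0)}\|,$$ $$\sin\angle(\hat u_i^{(k)},u_i)\le\frac{\|\Sigma_A\|}{\hat c_i^{(k)}}\sin\angle(\hat x_i^{(k)},x_i)_H,\qquad \sin\angle(\hat v_i^{(k)},v_i)\le\frac{\|\Sigma_B\|}{\hat s_i^{(k)}}\sin\angle(\hat x_i^{(k)},x_i)_H,$$ $$\chi\bigl((\hat\sigma_i^{(k)})^2,\sigma_i^2\bigr)\le 2\sin^2\angle(\hat x_i^{(k)},x_i)_H.$$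
   Context: $A\in\mathbb{R}^{m_1\times n}$, $B\in\mathbb{R}^{m_2\times n}$, $m_1+m_2\ge n$, $[A^T,B^T]^T$ of full column rank; $H=A^TA+B^TB$. GSVD: $U^TAX=\Sigma_A$, $V^TBX=\Sigma_B$, $X=[x_1,\dots,x_n]$ nonsingular with $X^THX=I$, $U,V$ orthogonal, $\Sigma_A^T\Sigma_A=\mathrm{diag}(c_1^2,\dots,c_n^2)$, $\Sigma_B^T\Sigma_B=\mathrm{diag}(s_1^2,\dots,s_n^2)$, $c_i,s_i\ge0$, $c_i^2+s_i^2=1$; for nontrivial $i$ ($0<c_i<1$), $u_i,v_i$ are the columns of $U,V$ with $Ax_i=c_iu_i$, $Bx_i=s_iv_i$, and $\sigma_i=c_i/s_i$. $S=H^{-1}(A^TA-B^TB)$. Given $[c_{\min},c_{\max}]\subset[0,1]$ and degree $d$: $l(z)=2z^2-1$, $\alpha=\arccos(l(c_{\min}))$, $\beta=\arccos(l(c_{\max}))$, $\eta_0=(\alpha-\beta)/\pi$, $\eta_j=2(\sin(j\alpha)-\sin(j\beta))/(j\pi)$, $\rho_{j,d}=\frac{(d+2-j)\sin\frac{\pi}{d+2}\cos\frac{j\pi}{d+2}+\cos\frac{\pi}{d+2}\sin\frac{j\pi}{d+2}}{(d+2)\sin\frac{\pi}{d+2}}$, $P=\sum_{j=0}^d\rho_{j,d}\eta_jT_j(S)$ ($T_j$ Chebyshev polynomials), so $Px_i=\gamma_ix_i$ with $\gamma_i=\psi_d(l(c_i))$, $\psi_d(x)=\sum_j\rho_{j,d}\eta_jT_j(x)$.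 Indexing: $c_1,\dots,c_r\in(c_{\min},c_{\max})$, $c_{r+1},\dots,c_{n_{gv}}\in\{c_{\min},c_{\max}\}$, $c_{n_{gv}+1},\dots,c_n\notin[c_{\min},c_{\max}]$, $\gamma_i$ decreasing within each group. $p\ge n_{gv}$, $X_p=[x_1,\dots,x_p]$, $X_{p,\perp}=[x_{p+1},\dots,x_n]$, $\gamma_p>\gamma_{p+1}$, and $X_p^THX^{(0)}$ nonsingular; $E^{(0)}=X_{p,\perp}^THX^{(0)}(X_p^THX^{(0)})^{-1}$. Algorithm: $X^{(0)}\in\mathbb{R}^{n\times p}$ of full column rank; at iteration $k$: thin QR $X^{(k)}=Q^{(k)}R^{(k)}$, $AQ^{(k)}=Q_1^{(k)}\bar A^{(k)}$, $BQ^{(k)}=Q_2^{(k)}\bar B^{(k)}$ (full column rank assumed); GSVD $\bar A^{(k)}=\bar U^{(k)}\mathrm{diag}(\hat c_i^{(k)})(\bar X^{(k)})^{-1}$, $\bar B^{(k)}=\bar V^{(k)}\mathrm{diag}(\hat s_i^{(k)})(\bar X^{(k)})^{-1}$; $\hat X^{(k)}=Q^{(k)}\bar X^{(k)}$ ($H$-orthonormal), $\hat U^{(k)}=Q_1^{(k)}\bar U^{(k)}$, $\hat V^{(k)}=Q_2^{(k)}\bar V^{(k)}$; Ritz quintuples $(\hat c_i^{(k)},\hat s_i^{(k)},\hat u_i^{(k)},\hat v_i^{(k)},\hat x_i^{(k)})=(\hat c_i^{(k)},\hat s_i^{(k)},\hat U^{(k)}e_i,\hat V^{(k)}e_i,\hat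 X^{(k)}e_i)$, labeled for $i=1,\dots,n_{gv}$ so that $\hat c_1^{(k)},\dots,\hat c_{n_{gv}}^{(k)}$ are in the same order as $c_1,\dots,c_{n_{gv}}$; $\hat\sigma_i^{(k)}=\hat c_i^{(k)}/\hat s_i^{(k)}$; next iterate $X^{(k+1)}=P\hat X^{(k)}$. $H$-angle: $\cos\angle(y,z)_H=\frac{y^THz}{\|H^{1/2}y\|\,\|H^{1/2}z\|}$, $\sin\angle(y,z)_H=\sqrt{1-\cos^2\angle(y,z)_H}$. Chordal metric $\chi(\lambda,\mu)=|\lambda-\mu|/(\sqrt{1+|\lambda|^2}\sqrt{1+|\mu|^2})$. *)

theory Defs
  imports Complex_Main "Jordan_Normal_Form.Matrix"
begin

definition vnorm :: "real vec \<Rightarrow> real" where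
  "vnorm v = sqrt (v \<bullet> v)"

definition opnorm :: "real mat \<Rightarrow> real" where
  "opnorm M = Sup ((\<lambda>v. vnorm (M *\<^sub>v v)) ` {v \<in> carrier_vec (dim_col M). vnorm v \<le> 1})"

definition sym_mat :: "real mat \<Rightarrow> bool" where
  "sym_mat M \<longleftrightarrow> transpose_mat M = M"

definition pos_def_mat :: "nat \<Rightarrow> real mat \<Rightarrow> bool" where
  "pos_def_mat n M \<longleftrightarrow> M \<in> carrier_mat n n \<and> sym_mat M \<and>
     (\<forall>v \<in> carrier_vec n. v \<noteq> 0\<^sub>v n \<longrightarrow> v \<bullet> (M *\<^sub>v v) > 0)"

definition minv :: "nat \<Rightarrow> real mat \<Rightarrow> real mat" where
  "minv n M = (THE N. N \<in> carrier_mat n n \<and> M * N = 1\<^sub>m n \<and> N * M = 1\<^sub>m n)"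

definition msqrt :: "nat \<Rightarrow> real mat \<Rightarrow> real mat" where
  "msqrt n M = (THE R. pos_def_mat n R \<and> R * R = M)"

definition full_col_rank :: "real mat \<Rightarrow> bool" where
  "full_col_rank M \<longleftrightarrow> (\<forall>v \<in> carrier_vec (dim_col M). M *\<^sub>v v = 0\<^sub>v (dim_row M) \<longrightarrow> v = 0\<^sub>v (dim_col M))"

definition col_space :: "real mat \<Rightarrow> real vec set" where
  "col_space M = {M *\<^sub>v v | v. v \<in> carrier_vec (dim_col M)}"

definition orth_proj :: "nat \<Rightarrow> real mat \<Rightarrow> real mat" where
  "orth_proj n W = (THE P. P \<in> carrier_mat n n \<and> sym_mat P \<and> P * P = P \<and> col_space P = col_space W)"

definition lead_cols :: "nat \<Rightarrow> real mat \<Rightarrow> real mat" where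
  "lead_cols p X = mat (dim_row X) p (\<lambda>(i,j). X $$ (i,j))"

definition trail_cols :: "nat \<Rightarrow> real mat \<Rightarrow> real mat" where
  "trail_cols p X = mat (dim_row X) (dim_col X - p) (\<lambda>(i,j). X $$ (i, j + p))"

fun msum :: "nat \<Rightarrow> (nat \<Rightarrow> real mat) \<Rightarrow> nat \<Rightarrow> real mat" where
  "msum n f 0 = 0\<^sub>m n n"
| "msum n f (Suc j) = msum n f j + f j"

fun cheb :: "nat \<Rightarrow> real \<Rightarrow> real" where
  "cheb 0 x = 1"
| "cheb (Suc 0) x = x"
| "cheb (Suc (Suc j)) x = 2 * x * cheb (Suc j) x - cheb j x"

fun cheb_mat :: "nat \<Rightarrow> nat \<Rightarrow> real mat \<Rightarrow> real mat" where
  "cheb_mat n 0 S = 1\<^sub>m n"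
| "cheb_mat n (Suc 0) S = S"
| "cheb_mat n (Suc (Suc j)) S = 2 \<cdot>\<^sub>m (S * cheb_mat n (Suc j) S) - cheb_mat n j S"

definition lmap :: "real \<Rightarrow> real" where
  "lmap z = 2 * z\<^sup>2 - 1"

definition eta :: "real \<Rightarrow> real \<Rightarrow> nat \<Rightarrow> real" where
  "eta cmin cmax j =
     (let a = arccos (lmap cmin); b = arccos (lmap cmax) in
      if j = 0 then (a - b) / pi
      else 2 * (sin (real j * a) - sin (real j * b)) / (real j * pi))"

definition rho :: "nat \<Rightarrow> nat \<Rightarrow> real" where
  "rho d j =
     (let t = pi / real (d + 2) in
      ((real (d + 2) - real j) * sin t * cos (real j * t) + cos t * sin (real j * t))
        / (real (d + 2) * sin t))"

definition psi :: "real \<Rightarrow> real \<Rightarrow> nat \<Rightarrow> real \<Rightarrow> real" where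
  "psi cmin cmax d x = (\<Sum>j\<le>d. rho d j * eta cmin cmax j * cheb j x)"

definition filter_mat :: "nat \<Rightarrow> real \<Rightarrow> real \<Rightarrow> nat \<Rightarrow> real mat \<Rightarrow> real mat" where
  "filter_mat n cmin cmax d S = msum n (\<lambda>j. (rho d j * eta cmin cmax j) \<cdot>\<^sub>m cheb_mat n j S) (Suc d)"

definition cosH :: "real mat \<Rightarrow> real vec \<Rightarrow> real vec \<Rightarrow> real" where
  "cosH H y z = (y \<bullet> (H *\<^sub>v z)) / (sqrt (y \<bullet> (H *\<^sub>v y)) * sqrt (z \<bullet> (H *\<^sub>v z)))"

definition sinH :: "real mat \<Rightarrow> real vec \<Rightarrow> real vec \<Rightarrow> real" where
  "sinH H y z = sqrt (1 - (cosH H y z)\<^sup>2)"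

definition sin_angle :: "real vec \<Rightarrow> real vec \<Rightarrow> real" where
  "sin_angle y z = sqrt (1 - ((y \<bullet> z) / (vnorm y * vnorm z))\<^sup>2)"

definition chordal :: "real \<Rightarrow> real \<Rightarrow> real" where
  "chordal l m = \<bar>l - m\<bar> / (sqrt (1 + l\<^sup>2) * sqrt (1 + m\<^sup>2))"

text \<open>The factor \<open>sqrt (1 + \<beta>^2/\<delta>^2)\<close> with \<open>\<delta> = min G\<close>; when the index set defining
  the minimum is empty, \<open>\<delta> = +\<infinity>\<close> and the factor is \<open>1\<close>.\<close>
definition gap_factor :: "real \<Rightarrow> real set \<Rightarrow> real" where
  "gap_factor \<beta> G = (if G = {} then 1 else sqrt (1 + \<beta>\<^sup>2 / (Min G)\<^sup>2))"

end

theory Submission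
  imports Defs "Jordan_Normal_Form.Spectral_Radius"
begin

text \<open>
  The half-sine autocorrelation behind the Jackson factors makes the damped Chebyshev kernel a
  squared modulus, so the filter \<open>psi\<close> is an average of a nonnegative kernel over an interval and is
  strictly positive on \<open>[-1, 1]\<close>.  Hence in the coordinates given by \<open>X\<close> the \<open>k\<close>-th Ritz space contains
  \<open>x\<^sub>i\<close> plus a tail of \<open>H\<close>-norm at most \<open>(\<gamma>\<^sub>p / \<gamma>\<^sub>i)\<^sup>k \<parallel>E0\<parallel>\<close>.  Saad's argument, applied to
  \<open>H\<^bsup>-1/2\<^esup> A\<^sup>T A H\<^bsup>-1/2\<^esup>\<close>, passes from the distance between \<open>x\<^sub>i\<close> and the Ritz space to the angle with
  the Ritz vector.  The remaining bounds follow by splitting the Ritz vector \<open>H\<close>-orthogonally along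
  \<open>x\<^sub>i\<close>: the error component is mapped by \<open>A\<close> and \<open>B\<close> with norms at most \<open>\<parallel>SA\<parallel>\<close> and \<open>\<parallel>SB\<parallel>\<close>, and it
  enters the Rayleigh quotient only to second order.
\<close>

section \<open>Positivity of the Jackson--Chebyshev filter\<close>

text \<open>Positivity of the filter carries two loads. The final bound divides by
  \<open>\<gamma> i\<close>, and for the unwanted indices the decreasing order of the \<gamma>'s
  controls their powers only if none of them is negative. A truncated Chebyshev series of an
  indicator function can oscillate below zero; the Jackson damping is what prevents this. The
  objects \<open>minv\<close>, \<open>msqrt\<close> and \<open>orth_proj\<close> are definite
  descriptions, about which nothing is known until existence and uniqueness are shown. For the
  square root this calls for a spectral theorem for real symmetric matrices. The root then matters
  only for \<beta>: all other estimates use the H-inner product directly, for which X is an isometry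
  from Euclidean coordinates with inverse \<open>X\<^sup>T * H\<close>. Columns are counted from 0,
  so \<open>\<gamma> p\<close> is the first value outside the leading block, which is the value with
  index p + 1 in the informal statement.\<close>

lemma trig_autocorrelation:
  fixes a :: "nat \<Rightarrow> real"
  shows "(\<Sum>k\<le>d. a k * cos (real k * x))\<^sup>2 + (\<Sum>k\<le>d. a k * sin (real k * x))\<^sup>2
     = (\<Sum>j\<le>d. (if j = 0 then 1 else 2) * (\<Sum>k\<le>d - j. a k * a (k + j)) * cos (real j * x))"
proof (induction d)
  case 0
  show ?case by (simp add: power2_eq_square)
next
  case (Suc d)
  let ?w = "\<lambda>j::nat. if j = 0 then 1 else 2 :: real"
  let ?C = "\<Sum>k\<le>d. a k * cos (real k * x)"
  let ?S = "\<Sum>k\<le>d. a k * sin (real k * x)"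
  let ?D = "real (Suc d) * x"
  \<comment> \<open>The left side is the squared modulus of the sum of a k e^(ikx). Raising d by one
    adds the pairs that contain the new index: one square, and cross terms that depend on index
    differences only.\<close>
  have cross: "?C * cos ?D + ?S * sin ?D = (\<Sum>l\<le>d. a l * cos (real (Suc d - l) * x))"
  proof -
    have "?C * cos ?D + ?S * sin ?D
        = (\<Sum>l\<le>d. a l * (cos ?D * cos (real l * x) + sin ?D * sin (real l * x)))"
      unfolding sum_distrib_right sum.distrib[symmetric]
      by (rule sum.cong[OF refl]) (simp add: algebra_simps)
    also have "\<dots> = (\<Sum>l\<le>d. a l * cos (real (Suc d - l) * x))"
    proof (rule sum.cong[OF refl])
      fix l assume "l \<in> {..d}"
      then have "real (Suc d - l) * x = ?D - real l * x" by (simp add: of_nat_diff algebra_simps)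
      then show "a l * (cos ?D * cos (real l * x) + sin ?D * sin (real l * x))
          = a l * cos (real (Suc d - l) * x)"
        by (simp only: cos_diff)
    qed
    finally show ?thesis .
  qed
  have "(\<Sum>k\<le>Suc d. a k * cos (real k * x))\<^sup>2 + (\<Sum>k\<le>Suc d. a k * sin (real k * x))\<^sup>2
      = (?C + a (Suc d) * cos ?D)\<^sup>2 + (?S + a (Suc d) * sin ?D)\<^sup>2" by simp
  also have "\<dots> = ?C\<^sup>2 + ?S\<^sup>2 + 2 * a (Suc d) * (?C * cos ?D + ?S * sin ?D)
      + (a (Suc d))\<^sup>2 * ((cos ?D)\<^sup>2 + (sin ?D)\<^sup>2)"
  proof -
    have "(C + b * p)\<^sup>2 + (S + b * q)\<^sup>2 = C\<^sup>2 + S\<^sup>2 + 2 * b * (C * p + S * q) + b\<^sup>2 * (p\<^sup>2 + q\<^sup>2)"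
      for C S b p q :: real
      by (simp add: power2_eq_square algebra_simps)
    then show ?thesis .
  qed
  also have "\<dots> = ?C\<^sup>2 + ?S\<^sup>2 + 2 * a (Suc d) * (\<Sum>l\<le>d. a l * cos (real (Suc d - l) * x))
      + (a (Suc d))\<^sup>2"
    unfolding cross by simp
  also have "(\<Sum>l\<le>d. a l * cos (real (Suc d - l) * x))
      = (\<Sum>j=1..Suc d. a (Suc d - j) * cos (real j * x))"
    by (rule sum.reindex_bij_witness[of _ "\<lambda>j. Suc d - j" "\<lambda>l. Suc d - l"]) auto
  finally have L: "(\<Sum>k\<le>Suc d. a k * cos (real k * x))\<^sup>2 + (\<Sum>k\<le>Suc d. a k * sin (real k * x))\<^sup>2
      = ?C\<^sup>2 + ?S\<^sup>2 + 2 * a (Suc d) * (\<Sum>j=1..Suc d. a (Suc d - j) * cos (real j * x))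
        + (a (Suc d))\<^sup>2" .
  \<comment> \<open>Each lag gains exactly one product. The conditional is there for the new lag
    \<open>Suc d\<close>, where truncated subtraction would leave a spurious term k = 0.\<close>
  have step: "(\<Sum>k\<le>Suc d - j. a k * a (k + j))
      = (if j \<le> d then \<Sum>k\<le>d - j. a k * a (k + j) else 0) + a (Suc d - j) * a (Suc d)"
    if "j \<le> Suc d" for j
    using that by (auto simp: Suc_diff_le le_Suc_eq)
  have "(\<Sum>j\<le>Suc d. ?w j * (\<Sum>k\<le>Suc d - j. a k * a (k + j)) * cos (real j * x))
     = (\<Sum>j\<le>Suc d. ?w j * (if j \<le> d then \<Sum>k\<le>d - j. a k * a (k + j) else 0) * cos (real j * x))
       + (\<Sum>j\<le>Suc d. ?w j * (a (Suc d - j) * a (Suc d)) * cos (real j * x))"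
    unfolding sum.distrib[symmetric]
    by (rule sum.cong[OF refl]) (simp only: step atMost_iff, simp only: algebra_simps)
  also have "(\<Sum>j\<le>Suc d. ?w j * (if j \<le> d then \<Sum>k\<le>d - j. a k * a (k + j) else 0) * cos (real j * x))
      = (\<Sum>j\<le>d. ?w j * (\<Sum>k\<le>d - j. a k * a (k + j)) * cos (real j * x))" by simp
  also have "\<dots> = ?C\<^sup>2 + ?S\<^sup>2" by (rule Suc.IH[symmetric])
  also have "(\<Sum>j\<le>Suc d. ?w j * (a (Suc d - j) * a (Suc d)) * cos (real j * x))
      = (a (Suc d))\<^sup>2 + (\<Sum>j=1..Suc d. ?w j * (a (Suc d - j) * a (Suc d)) * cos (real j * x))"
  proof -
    have "{..Suc d} = insert 0 {1..Suc d}" by auto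
    then show ?thesis by (simp only: sum.insert_if) (simp add: power2_eq_square)
  qed
  also have "(\<Sum>j=1..Suc d. ?w j * (a (Suc d - j) * a (Suc d)) * cos (real j * x))
      = 2 * a (Suc d) * (\<Sum>j=1..Suc d. a (Suc d - j) * cos (real j * x))"
    unfolding sum_distrib_left by (rule sum.cong) auto
  finally show ?case unfolding L by simp
qed

text \<open>The half-sine window, positive on 0..d and zero at the neighbouring indices -1 and d +
  1. It is Fejer's extremal choice: after normalisation its autocorrelation has the largest first
  coefficient among nonnegative cosine polynomials of degree d with mean 1.\<close>

definition jackson_coeff :: "nat \<Rightarrow> nat \<Rightarrow> real" where
  "jackson_coeff d k = sin (real (Suc k) * (pi / real (d + 2)))"

lemma sin_pi_div_pos: "0 < sin (pi / real (d + 2))"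
  by (rule sin_gt_zero) (simp_all add: divide_less_eq)

text \<open>The Jackson damping factors are the normalised autocorrelation of the half-sine window,
  which is why the damped Dirichlet kernel is a square.\<close>

lemma rho_autocorrelation:
  assumes "j \<le> d"
  shows "rho d j = 2 / real (d + 2) * (\<Sum>k\<le>d - j. jackson_coeff d k * jackson_coeff d (k + j))"
proof -
  define t where "t = pi / real (d + 2)"
  have st: "sin t > 0" unfolding t_def by (rule sin_pi_div_pos)
  have Nt: "real (d + 2) * t = pi" unfolding t_def by simp
  \<comment> \<open>The angles are spaced by 2t, so multiplication by \<open>2 * sin t\<close> makes
    the sum telescope.\<close>
  have tele: "(\<Sum>k\<le>m. 2 * sin t * cos (real (2 * k + 2 + j) * t))
      = sin (real (2 * m + 3 + j) * t) - sin (real (j + 1) * t)" for m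
  proof -
    have diff: "2 * sin t * cos (real (2 * k + 2 + j) * t)
        = sin (real (2 * k + 3 + j) * t) - sin (real (2 * k + 1 + j) * t)" for k
    proof -
      have "real (2 * k + 3 + j) * t = real (2 * k + 2 + j) * t + t"
        "real (2 * k + 1 + j) * t = real (2 * k + 2 + j) * t - t"
        by (simp_all add: algebra_simps)
      then show ?thesis by (simp only: sin_add sin_diff) simp
    qed
    show ?thesis unfolding diff
    proof (induction m)
      case 0
      show ?case by (simp add: algebra_simps)
    next
      case (Suc m)
      have "2 * Suc m + 1 + j = 2 * m + 3 + j" by simp
      then show ?case using Suc by (simp only: sum.atMost_Suc)
    qed
  qed
  \<comment> \<open>Because (d + 2) t = pi, the upper end of the telescope is the reflection of the
    lower end, and the two boundary terms merge.\<close>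
  have "real (2 * (d - j) + 3 + j) * t = 2 * pi - real (j + 1) * t"
    unfolding Nt[symmetric] using assms by (simp add: of_nat_diff algebra_simps)
  then have "sin (real (2 * (d - j) + 3 + j) * t) = - sin (real (j + 1) * t)"
    by (simp only: sin_diff sin_two_pi cos_two_pi)
  with tele[of "d - j"]
  have cs: "sin t * (\<Sum>k\<le>d - j. cos (real (2 * k + 2 + j) * t)) = - sin (real (j + 1) * t)"
    by (simp add: sum_distrib_left[symmetric] mult.assoc)
  have prod: "jackson_coeff d k * jackson_coeff d (k + j)
      = (cos (real j * t) - cos (real (2 * k + 2 + j) * t)) / 2" for k
  proof -
    have "real j * t = real (Suc (k + j)) * t - real (Suc k) * t"
      "real (2 * k + 2 + j) * t = real (Suc (k + j)) * t + real (Suc k) * t"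
      by (simp_all add: algebra_simps)
    then show ?thesis unfolding jackson_coeff_def t_def[symmetric]
      by (simp only: cos_add cos_diff) simp
  qed
  have "2 * sin t * (\<Sum>k\<le>d - j. jackson_coeff d k * jackson_coeff d (k + j))
      = sin t * (\<Sum>k\<le>d - j. cos (real j * t))
        - sin t * (\<Sum>k\<le>d - j. cos (real (2 * k + 2 + j) * t))"
    unfolding prod sum_divide_distrib[symmetric] sum_subtractf
    by (simp only: right_diff_distrib[symmetric])
  also have "\<dots> = (real (d + 1) - real j) * sin t * cos (real j * t) + sin (real (j + 1) * t)"
    unfolding cs using assms by (simp add: of_nat_diff algebra_simps)
  also have "sin (real (j + 1) * t) = sin (real j * t) * cos t + cos (real j * t) * sin t"
    by (simp add: algebra_simps sin_add)
  finally have "2 * sin t * (\<Sum>k\<le>d - j. jackson_coeff d k * jackson_coeff d (k + j))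
      = (real (d + 2) - real j) * sin t * cos (real j * t) + cos t * sin (real j * t)"
    by (simp add: algebra_simps)
  then show ?thesis
    unfolding rho_def Let_def t_def[symmetric] using st
    by (simp add: divide_simps mult_ac)
qed

text \<open>This is the two-sided exponential sum over -d..d; the factor 2 folds the index -j onto
  j.\<close>

definition jackson_kernel :: "nat \<Rightarrow> real \<Rightarrow> real" where
  "jackson_kernel d x = (\<Sum>j\<le>d. (if j = 0 then 1 else 2) * rho d j * cos (real j * x))"

lemma jackson_kernel_eq:
  "jackson_kernel d x = 2 / real (d + 2) *
     (cmod (\<Sum>k\<le>d. of_real (jackson_coeff d k) * cis x ^ k))\<^sup>2"
proof -
  have "jackson_kernel d x = 2 / real (d + 2) *
    ((\<Sum>k\<le>d. jackson_coeff d k * cos (real k * x))\<^sup>2 + (\<Sum>k\<le>d. jackson_coeff d k * sin (real k * x))\<^sup>2)"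
    unfolding trig_autocorrelation jackson_kernel_def sum_distrib_left
    by (rule sum.cong[OF refl]) (simp add: rho_autocorrelation sum_distrib_left mult_ac)
  then show ?thesis by (simp add: cmod_power2 Complex.DeMoivre)
qed

lemma jackson_kernel_nonneg: "0 \<le> jackson_kernel d x"
  unfolding jackson_kernel_eq by simp

text \<open>Nonnegativity alone would not make the averages of the kernel strictly positive. On the
  unit circle the kernel is a positive multiple of the squared modulus of a polynomial whose
  constant coefficient is sin (pi / (d + 2)), so it has finitely many zeros there, whereas
  \<open>cis\<close> maps an interval to an infinite set. The length bound pi reduces injectivity to
  that of cos on [0, pi]; it is harmless because the endpoints will be values of
  \<open>arccos\<close>, up to a common shift.\<close>

lemma jackson_kernel_nonzero:
  assumes "a < b" "b - a \<le> pi"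
  obtains x where "a < x" "x < b" "0 < jackson_kernel d x"
proof -
  define q where "q = (\<Sum>k\<le>d. monom (complex_of_real (jackson_coeff d k)) k)"
  have "coeff q 0 = complex_of_real (jackson_coeff d 0)"
    unfolding q_def by (simp add: coeff_sum)
  then have "q \<noteq> 0" using sin_pi_div_pos[of d] by (auto simp: jackson_coeff_def)
  then have fin: "finite {z. poly q z = 0}" by (rule poly_roots_finite)
  have pq: "poly q (cis x) = (\<Sum>k\<le>d. of_real (jackson_coeff d k) * cis x ^ k)" for x
    unfolding q_def by (simp add: poly_sum poly_monom)
  have "inj_on cis {a<..<b}"
  proof (rule inj_onI)
    fix x y assume xy: "x \<in> {a<..<b}" "y \<in> {a<..<b}" "cis x = cis y"
    then have "cis (x - y) = 1" by (simp add: cis_divide[symmetric])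
    then have "cos (x - y) = 1" by (simp add: complex_eq_iff)
    then have "cos \<bar>x - y\<bar> = cos 0" by simp
    moreover have "0 \<le> \<bar>x - y\<bar>" "\<bar>x - y\<bar> \<le> pi" using xy assms by auto
    ultimately have "\<bar>x - y\<bar> = 0"
      using cos_inj_pi[of "\<bar>x - y\<bar>" 0] by simp
    then show "x = y" by simp
  qed
  then have "infinite (cis ` {a<..<b})" using infinite_Ioo[OF assms(1)] finite_imageD by blast
  then obtain x where x: "x \<in> {a<..<b}" "poly q (cis x) \<noteq> 0"
    using fin finite_subset[of "cis ` {a<..<b}" "{z. poly q z = 0}"] by blast
  then have "0 < (cmod (poly q (cis x)))\<^sup>2" by simp
  then have "0 < jackson_kernel d x" unfolding jackson_kernel_eq pq[symmetric]
    by (intro mult_pos_pos) auto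
  with x(1) show thesis by (intro that) auto
qed

section \<open>The filter as an average of the kernel\<close>

lemma cheb_cos: "cheb j (cos t) = cos (real j * t)"
proof (induction j "cos t" rule: cheb.induct)
  case (3 j)
  have "real (Suc (Suc j)) * t = real (Suc j) * t + t" "real j * t = real (Suc j) * t - t"
    by (simp_all add: algebra_simps)
  then have "cos (real (Suc (Suc j)) * t) + cos (real j * t) = 2 * cos t * cos (real (Suc j) * t)"
    by (simp only: cos_add cos_diff) simp
  then show ?case using 3 by simp
qed auto

text \<open>The numbers \<open>eta\<close> are the Chebyshev coefficients of the indicator of
  [lmap cmin, lmap cmax]. With x = cos th, pi times the filter value is therefore the integral over
  [be, al] of the mean of the kernel at y - th and y + th. An explicit antiderivative and its
  monotonicity take the place of the integral.\<close>

lemma psi_pos: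
  assumes c: "0 \<le> cmin" "cmin < cmax" "cmax \<le> 1" and x: "- 1 \<le> x" "x \<le> 1"
  shows "0 < psi cmin cmax d x"
proof -
  define al where "al = arccos (lmap cmin)"
  define be where "be = arccos (lmap cmax)"
  define th where "th = arccos x"
  have xth: "x = cos th" using x by (simp add: th_def)
  have l: "- 1 \<le> lmap cmin" "lmap cmin < lmap cmax" "lmap cmax \<le> 1"
    using c by (auto simp: lmap_def power_strict_mono power_le_one)
  have ab: "be < al" unfolding al_def be_def using l by (intro arccos_less_arccos) auto
  have abpi: "al - be \<le> pi"
    using arccos_bounded[of "lmap cmin"] arccos_bounded[of "lmap cmax"] l
    unfolding al_def be_def by auto
  define F where "F = (\<lambda>y. \<Sum>j\<le>d. rho d j * cos (real j * th) *
      (if j = 0 then y else 2 * sin (real j * y) / real j))"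
  define F' where "F' = (\<lambda>y. (jackson_kernel d (y - th) + jackson_kernel d (y + th)) / 2)"
  have F'_eq: "F' y = (\<Sum>j\<le>d. rho d j * cos (real j * th) *
      (if j = 0 then 1 else 2 * cos (real j * y)))" for y
    unfolding F'_def jackson_kernel_def sum.distrib[symmetric] sum_divide_distrib
    by (rule sum.cong[OF refl]) (simp add: right_diff_distrib distrib_left cos_add cos_diff)
  have D: "(F has_real_derivative F' y) (at y)" for y
    unfolding F_def F'_eq
  proof (rule DERIV_sum)
    fix j
    show "((\<lambda>y. rho d j * cos (real j * th) * (if j = 0 then y else 2 * sin (real j * y) / real j))
        has_real_derivative rho d j * cos (real j * th) * (if j = 0 then 1 else 2 * cos (real j * y))) (at y)"
      by (cases "j = 0") (auto intro!: derivative_eq_intros)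
  qed
  have nn: "0 \<le> F' y" for y unfolding F'_def using jackson_kernel_nonneg by simp
  have mono: "F y \<le> F z" if "y \<le> z" for y z
    using that D nn by (meson DERIV_nonneg_imp_nondecreasing)
  \<comment> \<open>Equal end values would make the nondecreasing F constant on [be, al], contrary
    to a point with positive derivative. One shifted kernel supplies that point; the other can only
    add to the derivative.\<close>
  have "F be \<noteq> F al"
  proof
    assume eq: "F be = F al"
    obtain y0 where y0: "be - th < y0" "y0 < al - th" "0 < jackson_kernel d y0"
      using jackson_kernel_nonzero[of "be - th" "al - th" d] ab abpi by auto
    define y where "y = y0 + th"
    have y: "be < y" "y < al" using y0 by (auto simp: y_def)
    have pos: "0 < F' y"
      unfolding F'_def y_def using y0(3) jackson_kernel_nonneg[of d "y0 + th + th"]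
      by (simp add: add_pos_nonneg)
    have const: "F z = F be" if "be \<le> z" "z \<le> al" for z
      using mono[OF that(1)] mono[OF that(2)] eq by simp
    have "F' y = 0"
    proof (rule DERIV_local_const[OF D, of "min (y - be) (al - y)"])
      show "0 < min (y - be) (al - y)" using y by simp
      show "\<forall>z. \<bar>y - z\<bar> < min (y - be) (al - y) \<longrightarrow> F y = F z"
      proof (intro allI impI)
        fix z assume "\<bar>y - z\<bar> < min (y - be) (al - y)"
        then have "be \<le> z" "z \<le> al" by linarith+
        then show "F y = F z" using const[of z] const[of y] y by simp
      qed
    qed
    with pos show False by simp
  qed
  with mono[of be al] ab have "F be < F al" by simp
  moreover have "pi * psi cmin cmax d x = F al - F be"
    unfolding psi_def F_def xth cheb_cos sum_subtractf[symmetric] sum_distrib_left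
    by (rule sum.cong[OF refl])
      (auto simp: eta_def al_def be_def Let_def field_simps)
  ultimately have "0 < pi * psi cmin cmax d x" by simp
  then show ?thesis by (simp add: zero_less_mult_iff)
qed

section \<open>Real symmetric matrices\<close>

lemma mat_eqI_mult_vec:
  fixes A B :: "'a :: comm_ring_1 mat"
  assumes A: "A \<in> carrier_mat m n" and B: "B \<in> carrier_mat m n"
    and eq: "\<And>x. x \<in> carrier_vec n \<Longrightarrow> A *\<^sub>v x = B *\<^sub>v x"
  shows "A = B"
proof (rule eq_matI)
  fix i j assume "i < dim_row B" "j < dim_col B"
  then have ij: "i < m" "j < n" using B by auto
  have "(A *\<^sub>v unit_vec n j) $ i = (B *\<^sub>v unit_vec n j) $ i"
    using eq by simp
  then show "A $$ (i, j) = B $$ (i, j)" using ij A B by simp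
qed (use A B in auto)

lemma mult_mat_zero_vec: "A \<in> carrier_mat m n \<Longrightarrow> A *\<^sub>v 0\<^sub>v n = (0\<^sub>v m :: real vec)"
  by (intro eq_vecI) auto

lemma scalar_prod_self_nonneg: "0 \<le> (x :: real vec) \<bullet> x"
  by (simp add: scalar_prod_def sum_nonneg)

lemma scalar_prod_self_eq_0:
  "(x :: real vec) \<in> carrier_vec n \<Longrightarrow> x \<bullet> x = 0 \<longleftrightarrow> x = 0\<^sub>v n"
  by (auto simp: scalar_prod_def sum_nonneg_eq_0_iff)

lemma scalar_prod_self_pos:
  "(x :: real vec) \<in> carrier_vec n \<Longrightarrow> x \<noteq> 0\<^sub>v n \<Longrightarrow> 0 < x \<bullet> x"
  using scalar_prod_self_eq_0[of x n] scalar_prod_self_nonneg[of x] by simp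

lemma mult_mat_vec_adjoint:
  fixes A :: "real mat"
  assumes "A \<in> carrier_mat m n" "x \<in> carrier_vec m" "y \<in> carrier_vec n"
  shows "x \<bullet> (A *\<^sub>v y) = (A\<^sup>T *\<^sub>v x) \<bullet> y"
  using transpose_vec_mult_scalar[OF assms(1,3,2)] assms
  by (simp add: comm_scalar_prod[of _ m] comm_scalar_prod[of _ n])

text \<open>The complexified matrix has an eigenvector a + ib. Symmetry equates b \<bullet> Ma with
  Mb \<bullet> a, which leaves Im k (a \<bullet> a + b \<bullet> b) = 0. The eigenvalue is thus
  real, and whichever of a and b is nonzero is a real eigenvector.\<close>

lemma symmetric_eigenpair:
  assumes M: "M \<in> carrier_mat n n" and sym: "M\<^sup>T = M" and n: "0 < n"
  obtains l q where "q \<in> carrier_vec n" "q \<bullet> q = (1 :: real)" "M *\<^sub>v q = l \<cdot>\<^sub>v q"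
proof -
  let ?C = "map_mat complex_of_real M"
  have "?C \<in> carrier_mat n n" using M by simp
  then have "spectrum ?C \<noteq> {}" using n by (rule spectrum_non_empty)
  then obtain k v where kv: "eigenvector ?C v k"
    unfolding spectrum_def eigenvalue_def by auto
  then have v: "v \<in> carrier_vec n" and v0: "v \<noteq> 0\<^sub>v n" and ev: "?C *\<^sub>v v = k \<cdot>\<^sub>v v"
    using M by (auto simp: eigenvector_def)
  define a where "a = map_vec Re v"
  define b where "b = map_vec Im v"
  have a: "a \<in> carrier_vec n" and b: "b \<in> carrier_vec n" using v by (auto simp: a_def b_def)
  have vi: "(\<Sum>j = 0..<n. complex_of_real (M $$ (i, j)) * v $ j) = k * v $ i" if "i < n" for i
    using arg_cong[OF ev, of "\<lambda>w. w $ i"] that M v by (simp add: scalar_prod_def)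
  have Ma: "M *\<^sub>v a = Re k \<cdot>\<^sub>v a - Im k \<cdot>\<^sub>v b"
  proof (rule eq_vecI)
    fix i assume "i < dim_vec (Re k \<cdot>\<^sub>v a - Im k \<cdot>\<^sub>v b)"
    then have i: "i < n" using b by simp
    show "(M *\<^sub>v a) $ i = (Re k \<cdot>\<^sub>v a - Im k \<cdot>\<^sub>v b) $ i"
      using arg_cong[OF vi[OF i], of Re] i M v by (simp add: scalar_prod_def a_def b_def)
  qed (use M a b in auto)
  have Mb: "M *\<^sub>v b = Im k \<cdot>\<^sub>v a + Re k \<cdot>\<^sub>v b"
  proof (rule eq_vecI)
    fix i assume "i < dim_vec (Im k \<cdot>\<^sub>v a + Re k \<cdot>\<^sub>v b)"
    then have i: "i < n" using b by simp
    show "(M *\<^sub>v b) $ i = (Im k \<cdot>\<^sub>v a + Re k \<cdot>\<^sub>v b) $ i"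
      using arg_cong[OF vi[OF i], of Im] i M v by (simp add: scalar_prod_def a_def b_def)
  qed (use M a b in auto)
  have ab0: "a \<noteq> 0\<^sub>v n \<or> b \<noteq> 0\<^sub>v n"
  proof (rule ccontr)
    assume "\<not> ?thesis"
    then have z: "a = 0\<^sub>v n" "b = 0\<^sub>v n" by auto
    have "v = 0\<^sub>v n"
    proof (rule eq_vecI)
      fix i assume "i < dim_vec (0\<^sub>v n :: complex vec)"
      then have i: "i < n" by simp
      have "Re (v $ i) = a $ i" "Im (v $ i) = b $ i" using i v by (auto simp: a_def b_def)
      then show "v $ i = 0\<^sub>v n $ i" using i z by (simp add: complex_eq_iff)
    qed (use v in auto)
    with v0 show False by simp
  qed
  have "b \<bullet> (M *\<^sub>v a) = (M *\<^sub>v b) \<bullet> a"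
    using mult_mat_vec_adjoint[OF M b a] sym by simp
  then have "Im k * (a \<bullet> a + b \<bullet> b) = 0"
    unfolding Ma Mb using a b
    by (simp add: scalar_prod_minus_distrib[of _ n] add_scalar_prod_distrib[of _ n]
        scalar_prod_smult_right smult_scalar_prod_distrib[of _ n] comm_scalar_prod[of b n a]
        algebra_simps)
  moreover have "0 < a \<bullet> a + b \<bullet> b"
    using ab0 scalar_prod_self_pos[OF a] scalar_prod_self_pos[OF b]
      scalar_prod_self_nonneg[of a] scalar_prod_self_nonneg[of b] by linarith
  ultimately have im: "Im k = 0" by simp
  have Ma': "M *\<^sub>v a = Re k \<cdot>\<^sub>v a" and Mb': "M *\<^sub>v b = Re k \<cdot>\<^sub>v b"
    unfolding Ma Mb im using a b by auto
  obtain w where w: "w \<in> carrier_vec n" "w \<noteq> 0\<^sub>v n" "M *\<^sub>v w = Re k \<cdot>\<^sub>v w"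
  proof (cases "a = 0\<^sub>v n")
    case True
    then show thesis using that[of b] ab0 b Mb' by auto
  next
    case False
    then show thesis using that[of a] a Ma' by auto
  qed
  define t where "t = 1 / sqrt (w \<bullet> w)"
  have wp: "0 < w \<bullet> w" using scalar_prod_self_pos w by auto
  show thesis
  proof (rule that[of "t \<cdot>\<^sub>v w" "Re k"])
    show "t \<cdot>\<^sub>v w \<in> carrier_vec n" using w by simp
    have "(t \<cdot>\<^sub>v w) \<bullet> (t \<cdot>\<^sub>v w) = t * t * (w \<bullet> w)"
      using w by simp
    also have "\<dots> = 1" using wp by (simp add: t_def)
    finally show "(t \<cdot>\<^sub>v w) \<bullet> (t \<cdot>\<^sub>v w) = 1" .
    show "M *\<^sub>v (t \<cdot>\<^sub>v w) = Re k \<cdot>\<^sub>v (t \<cdot>\<^sub>v w)"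
      using w mult_mat_vec[OF M w(1), of t] by (simp add: smult_smult_assoc mult.commute)
  qed
qed

text \<open>If \<open>q\<close> is the first unit vector then \<open>v = 0\<close>, and \<open>2 / 0 = 0\<close> turns the Householder
  reflection into the identity, as needed.\<close>

lemma householder_reflection:
  assumes q: "q \<in> carrier_vec n" "q \<bullet> q = (1 :: real)" and n: "0 < n"
  obtains W where "W \<in> carrier_mat n n" "W\<^sup>T = W" "W * W = 1\<^sub>m n" "W *\<^sub>v unit_vec n 0 = q"
proof -
  define v where "v = q - unit_vec n 0"
  define s where "s = 2 / (v \<bullet> v)"
  define W where "W = mat n n (\<lambda>(i, j). (if i = j then 1 else 0) - s * v $ i * v $ j)"
  have v: "v \<in> carrier_vec n" using q by (simp add: v_def)
  have W: "W \<in> carrier_mat n n" by (simp add: W_def)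
  have Wx: "W *\<^sub>v x = x - (s * (v \<bullet> x)) \<cdot>\<^sub>v v" if x: "x \<in> carrier_vec n" for x
  proof (rule eq_vecI)
    fix i assume "i < dim_vec (x - (s * (v \<bullet> x)) \<cdot>\<^sub>v v)"
    then have i: "i < n" using v by simp
    have "(W *\<^sub>v x) $ i = (\<Sum>j = 0..<n. ((if i = j then 1 else 0) - s * v $ i * v $ j) * x $ j)"
      using i x by (simp add: W_def scalar_prod_def)
    also have "\<dots> = (\<Sum>j = 0..<n. if i = j then x $ j else 0) - s * v $ i * (\<Sum>j = 0..<n. v $ j * x $ j)"
      unfolding sum_distrib_left sum_subtractf[symmetric]
      by (rule sum.cong[OF refl]) (simp add: algebra_simps)
    also have "\<dots> = (x - (s * (v \<bullet> x)) \<cdot>\<^sub>v v) $ i"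
      using i v x by (simp add: scalar_prod_def)
    finally show "(W *\<^sub>v x) $ i = (x - (s * (v \<bullet> x)) \<cdot>\<^sub>v v) $ i" .
  qed (use v W in auto)
  have ss: "s * s * (v \<bullet> v) = 2 * s" by (simp add: s_def)
  have "W * W = 1\<^sub>m n"
  proof (rule mat_eqI_mult_vec[of _ n n])
    fix x :: "real vec" assume x: "x \<in> carrier_vec n"
    have "v \<bullet> (x - (s * (v \<bullet> x)) \<cdot>\<^sub>v v) = v \<bullet> x - s * (v \<bullet> x) * (v \<bullet> v)"
      using x v by (simp add: scalar_prod_minus_distrib[of _ n])
    then have "W *\<^sub>v (W *\<^sub>v x) = x - (s * (v \<bullet> x)) \<cdot>\<^sub>v v
        - (s * (v \<bullet> x - s * (v \<bullet> x) * (v \<bullet> v))) \<cdot>\<^sub>v v"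
      using x v by (simp add: Wx)
    also have "s * (v \<bullet> x - s * (v \<bullet> x) * (v \<bullet> v)) = - (s * (v \<bullet> x))"
    proof -
      have "s * (v \<bullet> x - s * (v \<bullet> x) * (v \<bullet> v)) = s * (v \<bullet> x) - (s * s * (v \<bullet> v)) * (v \<bullet> x)"
        by (simp add: algebra_simps)
      then show ?thesis unfolding ss by simp
    qed
    also have "x - (s * (v \<bullet> x)) \<cdot>\<^sub>v v - (- (s * (v \<bullet> x))) \<cdot>\<^sub>v v = x"
      using x v by (intro eq_vecI) auto
    finally show "(W * W) *\<^sub>v x = 1\<^sub>m n *\<^sub>v x" using x W by simp
  qed (use W in auto)
  moreover have "W *\<^sub>v unit_vec n 0 = q"
  proof -
    \<comment> \<open>Since q and the first unit vector e both have length 1, the reflection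
      coefficient s (v \<bullet> e) equals -1 whenever v is nonzero, so W maps e to e + v =
      q.\<close>
    have vv: "v \<bullet> v = 2 - 2 * q $ 0"
      unfolding v_def using q n
      by (simp add: scalar_prod_minus_distrib[of _ n] minus_scalar_prod_distrib[of _ n]
          comm_scalar_prod[of "unit_vec n 0" n q])
    have ve: "v \<bullet> unit_vec n 0 = q $ 0 - 1"
      unfolding v_def using q n by (simp add: minus_scalar_prod_distrib[of _ n])
    show ?thesis
    proof (cases "v \<bullet> v = 0")
      case True
      then have "v = 0\<^sub>v n" using scalar_prod_self_eq_0[OF v] by simp
      have "q = unit_vec n 0"
      proof (rule eq_vecI)
        fix i assume "i < dim_vec (unit_vec n 0 :: real vec)"
        then have "i < n" by simp
        then show "q $ i = unit_vec n 0 $ i"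
          using q arg_cong[OF \<open>v = 0\<^sub>v n\<close>, of "\<lambda>w. w $ i"] by (simp add: v_def)
      qed (use q in auto)
      with True show ?thesis unfolding Wx[OF unit_vec_carrier] s_def using v
        by (intro eq_vecI) auto
    next
      case False
      then have "s * (q $ 0 - 1) = - 1" unfolding s_def vv by (simp add: field_simps)
      then show ?thesis unfolding Wx[OF unit_vec_carrier] ve
        using q by (intro eq_vecI) (auto simp: v_def)
    qed
  qed
  moreover have "W\<^sup>T = W" by (rule eq_matI) (auto simp: W_def)
  ultimately show thesis using that W by blast
qed


text \<open>The deflation step: the eigenvector equation fixes the first column, and symmetry copies
  it to the first row.\<close>

lemma four_block_mat_corner:
  fixes N :: "real mat"
  assumes N: "N \<in> carrier_mat (Suc n) (Suc n)" and sym: "N\<^sup>T = N"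
    and ev: "N *\<^sub>v unit_vec (Suc n) 0 = l \<cdot>\<^sub>v unit_vec (Suc n) 0"
  shows "N = four_block_mat (mat_diag 1 (\<lambda>_. l)) (0\<^sub>m 1 n) (0\<^sub>m n 1)
      (mat n n (\<lambda>(i, j). N $$ (Suc i, Suc j)))"
proof -
  have c0: "N $$ (i, 0) = (if i = 0 then l else 0)" if "i < Suc n" for i
    using arg_cong[OF ev, of "\<lambda>w. w $ i"] that N by (auto split: if_splits)
  have r0: "N $$ (0, i) = (if i = 0 then l else 0)" if "i < Suc n" for i
  proof -
    have "N $$ (0, i) = N\<^sup>T $$ (i, 0)" using that N by simp
    then show ?thesis unfolding sym using c0 that by simp
  qed
  show ?thesis
    by (rule eq_matI) (use N c0 r0 in \<open>auto simp: mat_diag_def\<close>)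
qed

lemma mult_block_diag_mat:
  fixes A1 :: "'a :: comm_ring_1 mat"
  assumes "A1 \<in> carrier_mat m m" "A2 \<in> carrier_mat m m" "D1 \<in> carrier_mat n n" "D2 \<in> carrier_mat n n"
  shows "four_block_mat A1 (0\<^sub>m m n) (0\<^sub>m n m) D1 * four_block_mat A2 (0\<^sub>m m n) (0\<^sub>m n m) D2
     = four_block_mat (A1 * A2) (0\<^sub>m m n) (0\<^sub>m n m) (D1 * D2)"
  by (subst mult_four_block_mat[of _ m m _ n _ n _ _ m _ n]) (use assms in auto)

lemma mat_diag_Suc:
  "mat_diag (Suc n) (case_nat l f)
     = four_block_mat (mat_diag 1 (\<lambda>_. l)) (0\<^sub>m 1 n) (0\<^sub>m n 1) (mat_diag n f)"
  by (rule eq_matI) (auto simp: mat_diag_def split: nat.split)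

lemma transpose_mat_diag: "(mat_diag n f)\<^sup>T = mat_diag n f"
  by (rule eq_matI) (auto simp: mat_diag_def)

text \<open>A Householder reflection W moves an eigenvector to the first unit vector, so that
  \<open>W * M * W\<close> splits off its eigenvalue and the remaining block falls under the
  induction hypothesis. \<open>case_nat l f\<close> prepends that eigenvalue to those of the
  block.\<close>

theorem spectral_decomposition_real:
  assumes "M \<in> carrier_mat n n" "M\<^sup>T = (M :: real mat)"
  shows "\<exists>Z f. Z \<in> carrier_mat n n \<and> Z\<^sup>T * Z = 1\<^sub>m n \<and> M = Z * mat_diag n f * Z\<^sup>T"
  using assms
proof (induction n arbitrary: M)
  case 0
  then show ?case by (intro exI[of _ "1\<^sub>m 0"] exI[of _ "\<lambda>_. 0"]) (auto intro!: eq_matI)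
next
  case (Suc n)
  note M = Suc.prems
  obtain l q where q: "q \<in> carrier_vec (Suc n)" "q \<bullet> q = 1" "M *\<^sub>v q = l \<cdot>\<^sub>v q"
    using symmetric_eigenpair[OF M] by blast
  obtain W where W: "W \<in> carrier_mat (Suc n) (Suc n)" "W\<^sup>T = W" "W * W = 1\<^sub>m (Suc n)"
      "W *\<^sub>v unit_vec (Suc n) 0 = q"
    using householder_reflection[OF q(1,2)] by blast
  have Wq: "W *\<^sub>v q = unit_vec (Suc n) 0"
    unfolding W(4)[symmetric] using W(1,3)
    by (simp add: assoc_mult_mat_vec[symmetric, of _ _ "Suc n" _ "Suc n"])
  define N where "N = W * M * W"
  have N: "N \<in> carrier_mat (Suc n) (Suc n)" using M W by (simp add: N_def)
  have Nsym: "N\<^sup>T = N"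
    unfolding N_def using M W
    by (simp add: transpose_mult[of _ "Suc n" "Suc n" _ "Suc n"] assoc_mult_mat[of _ "Suc n" "Suc n" _ "Suc n" _ "Suc n"])
  have Ne: "N *\<^sub>v unit_vec (Suc n) 0 = l \<cdot>\<^sub>v unit_vec (Suc n) 0"
    unfolding N_def using M W q Wq
    by (simp add: assoc_mult_mat_vec[of _ "Suc n" "Suc n" _ "Suc n"] mult_mat_vec[of _ "Suc n" "Suc n"])
  define N' where "N' = mat n n (\<lambda>(i, j). N $$ (Suc i, Suc j))"
  have Nblock: "N = four_block_mat (mat_diag 1 (\<lambda>_. l)) (0\<^sub>m 1 n) (0\<^sub>m n 1) N'"
    unfolding N'_def by (rule four_block_mat_corner[OF N Nsym Ne])
  have "N' \<in> carrier_mat n n" by (simp add: N'_def)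
  moreover have "N'\<^sup>T = N'"
  proof (rule eq_matI)
    fix i j assume "i < dim_row N'" "j < dim_col N'"
    then have ij: "i < n" "j < n" by (auto simp: N'_def)
    then have "N\<^sup>T $$ (Suc i, Suc j) = N $$ (Suc j, Suc i)" using N by simp
    then show "N'\<^sup>T $$ (i, j) = N' $$ (i, j)" using ij unfolding Nsym by (simp add: N'_def)
  qed (auto simp: N'_def)
  ultimately obtain Y f where Y: "Y \<in> carrier_mat n n" "Y\<^sup>T * Y = 1\<^sub>m n"
      and N': "N' = Y * mat_diag n f * Y\<^sup>T"
    using Suc.IH by blast
  define V where "V = four_block_mat (1\<^sub>m 1) (0\<^sub>m 1 n) (0\<^sub>m n 1) Y"
  have V: "V \<in> carrier_mat (Suc n) (Suc n)"
    unfolding V_def using four_block_carrier_mat[of "1\<^sub>m 1" 1 1 Y n n] Y by simp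
  have VT: "V\<^sup>T = four_block_mat (1\<^sub>m 1) (0\<^sub>m 1 n) (0\<^sub>m n 1) (Y\<^sup>T)"
    unfolding V_def using Y by (subst transpose_four_block_mat[of _ 1 1 _ n _ n]) auto
  have VV: "V\<^sup>T * V = 1\<^sub>m (Suc n)"
    unfolding VT unfolding V_def
    using Y by (simp add: mult_block_diag_mat del: One_nat_def) simp
  let ?D = "mat_diag (Suc n) (case_nat l f)"
  have ND: "N = V * ?D * V\<^sup>T"
    unfolding Nblock N' VT unfolding V_def mat_diag_Suc
    using Y by (simp add: mult_block_diag_mat mult_carrier_mat[of _ n n] mult_carrier_mat[of _ 1 1]
        left_mult_one_mat[of _ 1 1] right_mult_one_mat[of _ 1 1] del: One_nat_def)
  have MN: "M = W * N * W"
  proof -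
    have "W * N * W = (W * W) * M * (W * W)"
      unfolding N_def using M W(1) by (simp add: assoc_mult_mat[of _ "Suc n" "Suc n" _ "Suc n" _ "Suc n"])
    then show ?thesis using W(3) M by simp
  qed
  show ?case
  proof (intro exI conjI)
    show "W * V \<in> carrier_mat (Suc n) (Suc n)" using W V by simp
    have T: "(W * V)\<^sup>T = V\<^sup>T * W"
      using W V by (simp add: transpose_mult[of _ "Suc n" "Suc n" _ "Suc n"])
    have "V\<^sup>T * W * (W * V) = V\<^sup>T * (W * W) * V"
      using W(1) V by (simp add: assoc_mult_mat[of _ "Suc n" "Suc n" _ "Suc n" _ "Suc n"])
    then show "(W * V)\<^sup>T * (W * V) = 1\<^sub>m (Suc n)" unfolding T W(3) using V VV by simp
    show "M = W * V * ?D * (W * V)\<^sup>T"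
      unfolding T MN ND using W(1) V
      by (simp add: assoc_mult_mat[of _ "Suc n" "Suc n" _ "Suc n" _ "Suc n"]
          mult_carrier_mat[of _ "Suc n" "Suc n"])
  qed
qed


section \<open>Square roots, inverses and projectors\<close>

text \<open>For square matrices a right inverse is also a left inverse, and this settles existence
  and uniqueness in the definite description at once.\<close>

lemma minvI:
  assumes "M \<in> carrier_mat n n" "N \<in> carrier_mat n n" "M * N = 1\<^sub>m n"
  shows "minv n M = N"
  unfolding minv_def
proof (rule the_equality)
  have NM: "N * M = 1\<^sub>m n" using mat_mult_left_right_inverse assms by blast
  then show "N \<in> carrier_mat n n \<and> M * N = 1\<^sub>m n \<and> N * M = 1\<^sub>m n" using assms by simp
  fix K assume K: "K \<in> carrier_mat n n \<and> M * K = 1\<^sub>m n \<and> K * M = 1\<^sub>m n"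
  then have "K = (N * M) * K" using NM left_mult_one_mat[of K n n] by simp
  also have "\<dots> = N * (M * K)" using K assms by (intro assoc_mult_mat) auto
  finally show "K = N" using K assms by simp
qed

lemma minv_inverse:
  assumes M: "M \<in> carrier_mat n n" and inv: "invertible_mat M"
  shows "minv n M \<in> carrier_mat n n" "M * minv n M = 1\<^sub>m n" "minv n M * M = 1\<^sub>m n"
proof -
  obtain N where N: "M * N = 1\<^sub>m n" "N * M = 1\<^sub>m (dim_row N)"
    using inv M unfolding invertible_mat_def inverts_mat_def by auto
  have "dim_col N = n" using arg_cong[OF N(1), of dim_col] by simp
  moreover have "dim_row N = n" using arg_cong[OF N(2), of dim_col] M by simp
  ultimately have Nc: "N \<in> carrier_mat n n" by auto
  then have "minv n M = N" using minvI[OF M] N by blast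
  then show "minv n M \<in> carrier_mat n n" "M * minv n M = 1\<^sub>m n" "minv n M * M = 1\<^sub>m n"
    using N Nc by auto
qed

lemma mat_diag_mult_vec:
  assumes "x \<in> carrier_vec n"
  shows "mat_diag n f *\<^sub>v x = vec n (\<lambda>i. f i * (x $ i :: real))"
proof (rule eq_vecI)
  fix i assume "i < dim_vec (vec n (\<lambda>i. f i * (x $ i)))"
  then have i: "i < n" by simp
  have "(mat_diag n f *\<^sub>v x) $ i = (\<Sum>j = 0..<n. (if i = j then f j else 0) * x $ j)"
    using i assms by (simp add: mat_diag_def scalar_prod_def)
  also have "\<dots> = (\<Sum>j = 0..<n. if i = j then f j * x $ j else 0)"
    by (rule sum.cong) auto
  finally have "(mat_diag n f *\<^sub>v x) $ i = (\<Sum>j = 0..<n. if i = j then f j * x $ j else 0)" .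
  then show "(mat_diag n f *\<^sub>v x) $ i = vec n (\<lambda>i. f i * (x $ i)) $ i" using i by simp
qed (auto simp: mat_diag_def)

text \<open>In the coordinates \<open>Z\<^sup>T *\<^sub>v x\<close> the quadratic form is a sum of
  squares weighted by f. One direction certifies a constructed root, the other extracts positive
  eigenvalues from a given matrix.\<close>

lemma orthogonal_diag_pos_def:
  assumes Z: "Z \<in> carrier_mat n n" "Z\<^sup>T * Z = 1\<^sub>m n"
  shows "pos_def_mat n (Z * mat_diag n f * Z\<^sup>T) \<longleftrightarrow> (\<forall>i<n. 0 < f i)"
proof -
  let ?M = "Z * mat_diag n f * Z\<^sup>T"
  have M: "?M \<in> carrier_mat n n" using Z by (simp add: mult_carrier_mat[of _ n n])
  have ZZ: "Z * Z\<^sup>T = 1\<^sub>m n" using mat_mult_left_right_inverse[OF _ Z(1) Z(2)] Z by simp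
  have sym: "sym_mat ?M"
    unfolding sym_mat_def using Z
    by (simp add: transpose_mult[of _ n n _ n] mult_carrier_mat[of _ n n] transpose_mat_diag
        assoc_mult_mat[of _ n n _ n _ n])
  have quad: "x \<bullet> (?M *\<^sub>v x) = (\<Sum>i = 0..<n. f i * ((Z\<^sup>T *\<^sub>v x) $ i)\<^sup>2)" if x: "x \<in> carrier_vec n" for x
  proof -
    have zx: "Z\<^sup>T *\<^sub>v x \<in> carrier_vec n" using Z x by simp
    have "?M *\<^sub>v x = Z *\<^sub>v (mat_diag n f *\<^sub>v (Z\<^sup>T *\<^sub>v x))"
      using Z x by (simp add: assoc_mult_mat_vec[of _ n n _ n] mult_carrier_mat[of _ n n])
    then have "x \<bullet> (?M *\<^sub>v x) = (Z\<^sup>T *\<^sub>v x) \<bullet> (mat_diag n f *\<^sub>v (Z\<^sup>T *\<^sub>v x))"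
      using mult_mat_vec_adjoint[OF Z(1) x, of "mat_diag n f *\<^sub>v (Z\<^sup>T *\<^sub>v x)"] zx
      by (simp add: mult_mat_vec_carrier[of _ n n])
    then show ?thesis using zx
      by (simp add: mat_diag_mult_vec scalar_prod_def power2_eq_square algebra_simps)
  qed
  show ?thesis
  proof
    assume pd: "pos_def_mat n ?M"
    show "\<forall>i<n. 0 < f i"
    proof (intro allI impI)
      fix i assume i: "i < n"
      define z where "z = Z *\<^sub>v unit_vec n i"
      have z: "z \<in> carrier_vec n" using Z by (simp add: z_def)
      have Tz: "Z\<^sup>T *\<^sub>v z = unit_vec n i"
        unfolding z_def using Z by (simp add: assoc_mult_mat_vec[symmetric, of _ n n _ n])
      have "z \<noteq> 0\<^sub>v n"
      proof
        assume "z = 0\<^sub>v n"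
        then have "Z\<^sup>T *\<^sub>v z = 0\<^sub>v n" using mult_mat_zero_vec[of "Z\<^sup>T" n n] Z by simp
        then show False using arg_cong[OF Tz, of "\<lambda>w. w $ i"] i by simp
      qed
      then have "0 < z \<bullet> (?M *\<^sub>v z)" using pd z by (auto simp: pos_def_mat_def)
      also have "\<dots> = (\<Sum>j = 0..<n. if j = i then f j else 0)"
        unfolding quad[OF z] Tz using i by (intro sum.cong) auto
      finally show "0 < f i" using i by simp
    qed
  next
    assume f: "\<forall>i<n. 0 < f i"
    have "0 < x \<bullet> (?M *\<^sub>v x)" if x: "x \<in> carrier_vec n" "x \<noteq> 0\<^sub>v n" for x
    proof -
      have "Z *\<^sub>v (Z\<^sup>T *\<^sub>v x) = x"
        using Z x ZZ by (simp add: assoc_mult_mat_vec[symmetric, of _ n n _ n])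
      then have "Z\<^sup>T *\<^sub>v x \<noteq> 0\<^sub>v n" using x mult_mat_zero_vec[OF Z(1)] by metis
      then obtain i where i: "i < n" "(Z\<^sup>T *\<^sub>v x) $ i \<noteq> 0"
        using Z by (metis carrier_matD(2) dim_mult_mat_vec eq_vecI index_transpose_mat(2)
            index_zero_vec)
      show ?thesis unfolding quad[OF x(1)]
        by (rule sum_pos2[of _ i]) (use i f in \<open>auto simp: less_imp_le\<close>)
    qed
    then show "pos_def_mat n ?M" unfolding pos_def_mat_def using M sym by blast
  qed
qed

text \<open>Let z be an eigenvector of T with eigenvalue g > 0. From (R + g)(R - g) z = (R R - T T)
  z = 0, the vector w = (R - g) z satisfies R w = -g w. A positive definite R has no negative
  eigenvalue, so w = 0, and R agrees with T on an orthonormal eigenbasis.\<close>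

lemma pos_def_sqrt_unique:
  assumes R: "pos_def_mat n R" and T: "pos_def_mat n T" and eq: "R * R = T * T"
  shows "R = T"
proof -
  have Rc: "R \<in> carrier_mat n n" and Tc: "T \<in> carrier_mat n n" and Tsym: "T\<^sup>T = T"
    using R T by (auto simp: pos_def_mat_def sym_mat_def)
  obtain Z g where Z: "Z \<in> carrier_mat n n" "Z\<^sup>T * Z = 1\<^sub>m n" and TZ: "T = Z * mat_diag n g * Z\<^sup>T"
    using spectral_decomposition_real[OF Tc Tsym] by blast
  have ZZ: "Z * Z\<^sup>T = 1\<^sub>m n" using mat_mult_left_right_inverse[OF _ Z(1) Z(2)] Z by simp
  have g: "0 < g i" if "i < n" for i
    using T that unfolding TZ orthogonal_diag_pos_def[OF Z] by blast
  have "R * Z = T * Z"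
  proof (rule mat_col_eqI)
    fix i assume "i < dim_col (T * Z)"
    then have i: "i < n" using Z by simp
    define z where "z = col Z i"
    have z: "z \<in> carrier_vec n" using Z i by (simp add: z_def)
    have "T * Z = Z * mat_diag n g"
      unfolding TZ using Z by (simp add: assoc_mult_mat[of _ n n _ n _ n] mult_carrier_mat[of _ n n]
          right_mult_one_mat[of _ n n])
    then have "col (T * Z) i = col (Z * mat_diag n g) i" by simp
    also have "\<dots> = g i \<cdot>\<^sub>v z"
      unfolding mat_diag_mult_right[OF Z(1)] z_def using i Z by (intro eq_vecI) auto
    finally have Tz: "T *\<^sub>v z = g i \<cdot>\<^sub>v z" unfolding z_def col_mult2[OF Tc Z(1) i] .
    define w where "w = R *\<^sub>v z - g i \<cdot>\<^sub>v z"
    have w: "w \<in> carrier_vec n" using Rc z by (simp add: w_def)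
    have "R *\<^sub>v (R *\<^sub>v z) = T *\<^sub>v (T *\<^sub>v z)"
      using arg_cong[OF eq, of "\<lambda>M. M *\<^sub>v z"] Rc Tc z by simp
    also have "\<dots> = (g i * g i) \<cdot>\<^sub>v z"
      using Tc z by (simp add: Tz mult_mat_vec smult_smult_assoc)
    finally have "R *\<^sub>v w = (g i * g i) \<cdot>\<^sub>v z - g i \<cdot>\<^sub>v (R *\<^sub>v z)"
      unfolding w_def using Rc z by (simp add: mult_minus_distrib_mat_vec[of _ n n] mult_mat_vec)
    also have "\<dots> = - (g i) \<cdot>\<^sub>v w"
      unfolding w_def using Rc z by (intro eq_vecI) (auto simp: algebra_simps)
    finally have "w \<bullet> (R *\<^sub>v w) = - g i * (w \<bullet> w)" using w by simp
    then have "w \<bullet> (R *\<^sub>v w) \<le> 0"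
      using g[OF i] scalar_prod_self_nonneg[of w] by (simp add: mult_nonneg_nonneg)
    then have w0: "w = 0\<^sub>v n" using R w unfolding pos_def_mat_def by force
    have "R *\<^sub>v z = g i \<cdot>\<^sub>v z"
    proof (rule eq_vecI)
      fix j assume "j < dim_vec (g i \<cdot>\<^sub>v z)"
      then have "j < n" using z by simp
      then show "(R *\<^sub>v z) $ j = (g i \<cdot>\<^sub>v z) $ j"
        using arg_cong[OF w0, of "\<lambda>v. v $ j"] z Rc unfolding w_def by simp
    qed (use Rc z in auto)
    then show "col (R * Z) i = col (T * Z) i"
      using Tz unfolding z_def col_mult2[OF Tc Z(1) i] col_mult2[OF Rc Z(1) i] by simp
  qed (use Rc Tc Z in auto)
  then have "R * Z * Z\<^sup>T = T * Z * Z\<^sup>T" by simp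
  then show ?thesis using Rc Tc Z ZZ by (simp add: assoc_mult_mat[of _ n n _ n _ n])
qed

lemma msqrt_correct:
  assumes "pos_def_mat n M"
  shows "pos_def_mat n (msqrt n M)" "msqrt n M * msqrt n M = M"
proof -
  have M: "M \<in> carrier_mat n n" "M\<^sup>T = M" using assms by (auto simp: pos_def_mat_def sym_mat_def)
  obtain Z f where Z: "Z \<in> carrier_mat n n" "Z\<^sup>T * Z = 1\<^sub>m n" and MZ: "M = Z * mat_diag n f * Z\<^sup>T"
    using spectral_decomposition_real[OF M] by blast
  have f: "\<forall>i<n. 0 < f i" using assms unfolding MZ orthogonal_diag_pos_def[OF Z] .
  define R where "R = Z * mat_diag n (\<lambda>i. sqrt (f i)) * Z\<^sup>T"
  have R: "pos_def_mat n R" unfolding R_def orthogonal_diag_pos_def[OF Z] using f by simp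
  have "R * R = Z * mat_diag n (\<lambda>i. sqrt (f i)) * (Z\<^sup>T * Z) * mat_diag n (\<lambda>i. sqrt (f i)) * Z\<^sup>T"
    unfolding R_def using Z(1) by (simp add: assoc_mult_mat[of _ n n _ n _ n] mult_carrier_mat[of _ n n])
  also have "\<dots> = Z * (mat_diag n (\<lambda>i. sqrt (f i)) * mat_diag n (\<lambda>i. sqrt (f i))) * Z\<^sup>T"
    unfolding Z(2) using Z(1)
    by (simp add: assoc_mult_mat[of _ n n _ n _ n] mult_carrier_mat[of _ n n]
        left_mult_one_mat[of _ n n] del: mat_diag_diag)
  also have "mat_diag n (\<lambda>i. sqrt (f i)) * mat_diag n (\<lambda>i. sqrt (f i)) = mat_diag n f"
    unfolding mat_diag_diag using f by (intro eq_matI) (auto simp: mat_diag_def less_imp_le)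
  finally have RR: "R * R = M" unfolding MZ .
  have "msqrt n M = R"
    unfolding msqrt_def using R RR pos_def_sqrt_unique by (intro the_equality) auto
  with R RR show "pos_def_mat n (msqrt n M)" "msqrt n M * msqrt n M = M" by auto
qed

text \<open>For uniqueness, idempotents S and P with the same range absorb each other: S P = P and P
  S = S. If both are symmetric, transposing the first equation gives P S = P, hence S = P.\<close>

lemma orth_proj_eq:
  assumes W: "W \<in> carrier_mat n p" "W\<^sup>T * W = 1\<^sub>m p"
  shows "orth_proj n W = W * W\<^sup>T"
proof -
  let ?P = "W * W\<^sup>T"
  have P: "?P \<in> carrier_mat n n" using W by simp
  have sym: "?P\<^sup>T = ?P" using W by (simp add: transpose_mult[of _ n p])
  have "?P * ?P = W * (W\<^sup>T * W) * W\<^sup>T"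
    using W(1) by (simp add: assoc_mult_mat[of _ n p _ n _ n] assoc_mult_mat[of _ n p _ p _ n]
       assoc_mult_mat[of _ p n _ p _ n])
  then have idem: "?P * ?P = ?P" using W by simp
  have WTWx: "W\<^sup>T *\<^sub>v (W *\<^sub>v x) = x" if "x \<in> carrier_vec p" for x
    using that W by (simp add: assoc_mult_mat_vec[symmetric, of _ p n _ p])
  have Px: "?P *\<^sub>v x = W *\<^sub>v (W\<^sup>T *\<^sub>v x)" if "x \<in> carrier_vec n" for x
    using that W by (intro assoc_mult_mat_vec) auto
  have cs: "col_space ?P = col_space W"
  proof
    show "col_space ?P \<subseteq> col_space W"
      unfolding col_space_def using W Px by fastforce
    show "col_space W \<subseteq> col_space ?P"
    proof
      fix y assume "y \<in> col_space W"
      then obtain x where x: "x \<in> carrier_vec p" "y = W *\<^sub>v x" unfolding col_space_def using W by auto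
      then have "y = ?P *\<^sub>v (W *\<^sub>v x)" using W by (simp add: Px WTWx)
      moreover have "W *\<^sub>v x \<in> carrier_vec (dim_col ?P)" using W x by simp
      ultimately show "y \<in> col_space ?P" unfolding col_space_def by blast
    qed
  qed
  have fix_col: "S *\<^sub>v y = y" if "S \<in> carrier_mat n n" "S * S = S" "y \<in> col_space S" for S y
    using that by (auto simp: col_space_def assoc_mult_mat_vec[symmetric, of _ n n _ n])
  have absorb: "S * T = T" if S: "S \<in> carrier_mat n n" "S * S = S" and T: "T \<in> carrier_mat n n"
    and "col_space S = col_space T" for S T
  proof (rule mat_eqI_mult_vec[of _ n n])
    fix x :: "real vec" assume x: "x \<in> carrier_vec n"
    then have "T *\<^sub>v x \<in> col_space S" using T that(4) by (auto simp: col_space_def)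
    then show "(S * T) *\<^sub>v x = T *\<^sub>v x" using fix_col[OF S] S T x by simp
  qed (use S T in auto)
  show ?thesis unfolding orth_proj_def
  proof (rule the_equality)
    show "?P \<in> carrier_mat n n \<and> sym_mat ?P \<and> ?P * ?P = ?P \<and> col_space ?P = col_space W"
      using P sym idem cs by (simp add: sym_mat_def)
    fix S assume S: "S \<in> carrier_mat n n \<and> sym_mat S \<and> S * S = S \<and> col_space S = col_space W"
    then have "S * ?P = ?P" "?P * S = S" using absorb P idem cs by auto
    moreover have "(S * ?P)\<^sup>T = ?P * S"
      using S P sym by (simp add: transpose_mult[of _ n n _ n] sym_mat_def)
    ultimately show "S = ?P" using sym by simp
  qed
qed

section \<open>Norms\<close>

lemma vnorm_square: "(vnorm x)\<^sup>2 = x \<bullet> x"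
  unfolding vnorm_def by (simp add: scalar_prod_self_nonneg)

lemma vnorm_nonneg: "0 \<le> vnorm x"
  unfolding vnorm_def by (simp add: scalar_prod_self_nonneg)

lemma vnorm_smult: "vnorm (a \<cdot>\<^sub>v x) = \<bar>a\<bar> * vnorm x"
proof -
  have "(a \<cdot>\<^sub>v x) \<bullet> (a \<cdot>\<^sub>v x) = a\<^sup>2 * (x \<bullet> x)" by (simp add: power2_eq_square)
  then show ?thesis unfolding vnorm_def by (simp add: real_sqrt_mult)
qed

text \<open>Without boundedness the \<open>Sup\<close> in \<open>opnorm\<close> would bound nothing.
  Any finite bound will do, here one from the absolute row sums.\<close>

lemma opnorm_bdd_above:
  "bdd_above ((\<lambda>v. vnorm (M *\<^sub>v v)) ` {v \<in> carrier_vec (dim_col M). vnorm v \<le> 1})"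
proof (rule bdd_aboveI)
  fix t assume "t \<in> (\<lambda>v. vnorm (M *\<^sub>v v)) ` {v \<in> carrier_vec (dim_col M). vnorm v \<le> 1}"
  then obtain v where v: "v \<in> carrier_vec (dim_col M)" "vnorm v \<le> 1" "t = vnorm (M *\<^sub>v v)" by auto
  have vj: "\<bar>v $ j\<bar> \<le> 1" if "j < dim_col M" for j
  proof -
    have "(v $ j)\<^sup>2 \<le> (\<Sum>j = 0..<dim_col M. (v $ j)\<^sup>2)"
      using that by (intro member_le_sum) auto
    also have "\<dots> = (vnorm v)\<^sup>2" unfolding vnorm_square using v by (simp add: scalar_prod_def power2_eq_square)
    also have "\<dots> \<le> 1" using v vnorm_nonneg by (simp add: power_le_one)
    finally show ?thesis by (simp add: abs_square_le_1)
  qed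
  have "\<bar>(M *\<^sub>v v) $ i\<bar> \<le> (\<Sum>j = 0..<dim_col M. \<bar>M $$ (i, j)\<bar>)" if "i < dim_row M" for i
  proof -
    have "\<bar>(M *\<^sub>v v) $ i\<bar> \<le> (\<Sum>j = 0..<dim_col M. \<bar>M $$ (i, j)\<bar> * \<bar>v $ j\<bar>)"
      using that v by (auto simp: scalar_prod_def abs_mult[symmetric] intro!: sum_abs)
    also have "\<dots> \<le> (\<Sum>j = 0..<dim_col M. \<bar>M $$ (i, j)\<bar>)"
      using vj by (intro sum_mono) (simp add: mult_left_le)
    finally show ?thesis .
  qed
  then have "(M *\<^sub>v v) \<bullet> (M *\<^sub>v v) \<le> (\<Sum>i = 0..<dim_row M. (\<Sum>j = 0..<dim_col M. \<bar>M $$ (i, j)\<bar>)\<^sup>2)"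
    unfolding scalar_prod_def by (auto intro!: sum_mono simp: power2_eq_square[symmetric] abs_le_square_iff[symmetric])
  then show "t \<le> sqrt (\<Sum>i = 0..<dim_row M. (\<Sum>j = 0..<dim_col M. \<bar>M $$ (i, j)\<bar>)\<^sup>2)"
    unfolding v(3) vnorm_def by simp
qed

lemma opnorm_nonneg: "0 \<le> opnorm M"
proof -
  have "vnorm (M *\<^sub>v 0\<^sub>v (dim_col M)) \<le> opnorm M"
    unfolding opnorm_def by (rule cSup_upper[OF _ opnorm_bdd_above]) (auto simp: vnorm_def)
  then show ?thesis using vnorm_nonneg order_trans by blast
qed

lemma vnorm_mult_mat_vec_le:
  assumes M: "M \<in> carrier_mat m n" and x: "x \<in> carrier_vec n"
  shows "vnorm (M *\<^sub>v x) \<le> opnorm M * vnorm x"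
proof (cases "x = 0\<^sub>v n")
  case True
  then have "M *\<^sub>v x = 0\<^sub>v m" using mult_mat_zero_vec[OF M] by simp
  then show ?thesis using opnorm_nonneg vnorm_nonneg by (simp add: vnorm_def True)
next
  case False
  then have pos: "0 < vnorm x" unfolding vnorm_def using scalar_prod_self_pos[OF x] by simp
  define y where "y = (1 / vnorm x) \<cdot>\<^sub>v x"
  have y: "y \<in> carrier_vec n" "vnorm y = 1" using pos x by (auto simp: y_def vnorm_smult)
  have "vnorm (M *\<^sub>v y) \<le> opnorm M"
    unfolding opnorm_def by (rule cSup_upper[OF _ opnorm_bdd_above]) (use y M in auto)
  moreover have "M *\<^sub>v y = (1 / vnorm x) \<cdot>\<^sub>v (M *\<^sub>v x)"
    unfolding y_def using M x by (rule mult_mat_vec)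
  ultimately show ?thesis using pos by (simp add: vnorm_smult divide_simps)
qed

section \<open>Angles between exact and approximate vectors\<close>

text \<open>The GSVD enters through its Gram matrices: X diagonalises \<open>A\<^sup>T * A\<close>
  and H simultaneously, and then also their difference \<open>B\<^sup>T * B\<close>. The estimates
  become statements on the pencil of \<open>A\<^sup>T * A\<close> and H.\<close>

locale gsvd_pair =
  fixes A B X H :: "real mat" and m1 m2 n :: nat and c :: "nat \<Rightarrow> real"
  assumes A: "A \<in> carrier_mat m1 n" and B: "B \<in> carrier_mat m2 n" and X: "X \<in> carrier_mat n n"
    and H_def: "H = A\<^sup>T * A + B\<^sup>T * B"
    and XHX: "X\<^sup>T * H * X = 1\<^sub>m n"
    and XAX: "X\<^sup>T * (A\<^sup>T * A) * X = mat_diag n (\<lambda>i. (c i)\<^sup>2)"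
begin

lemma H: "H \<in> carrier_mat n n" unfolding H_def using A B by simp

lemma H_sym: "H\<^sup>T = H"
  unfolding H_def using A B
  by (simp add: transpose_add[of _ n n] transpose_mult[of _ n m1 _ n] transpose_mult[of _ n m2 _ n])

lemma H_mult_vec:
  assumes "y \<in> carrier_vec n"
  shows "H *\<^sub>v y = A\<^sup>T *\<^sub>v (A *\<^sub>v y) + B\<^sup>T *\<^sub>v (B *\<^sub>v y)"
  unfolding H_def using A B assms
  by (simp add: add_mult_distrib_mat_vec[of _ n n] assoc_mult_mat_vec[of _ n m1 _ n]
      assoc_mult_mat_vec[of _ n m2 _ n])

lemma H_quad:
  assumes "y \<in> carrier_vec n"
  shows "y \<bullet> (H *\<^sub>v y) = (vnorm (A *\<^sub>v y))\<^sup>2 + (vnorm (B *\<^sub>v y))\<^sup>2"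
  unfolding H_mult_vec[OF assms] vnorm_square using A B assms
  by (simp add: scalar_prod_add_distrib[of _ n] mult_mat_vec_adjoint[of "A\<^sup>T" n m1]
      mult_mat_vec_adjoint[of "B\<^sup>T" n m2])

lemma H_commute:
  assumes "y \<in> carrier_vec n" "z \<in> carrier_vec n"
  shows "y \<bullet> (H *\<^sub>v z) = z \<bullet> (H *\<^sub>v y)"
proof -
  have "y \<bullet> (H *\<^sub>v z) = (H *\<^sub>v y) \<bullet> z" using mult_mat_vec_adjoint[OF H assms] H_sym by simp
  also have "\<dots> = z \<bullet> (H *\<^sub>v y)" using H assms by (intro comm_scalar_prod[of _ n]) auto
  finally show ?thesis .
qed

lemma HX_inverse: "H * X * X\<^sup>T = 1\<^sub>m n" and XH_inverse: "X * (X\<^sup>T * H) = 1\<^sub>m n"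
proof -
  have "X\<^sup>T * (H * X) = 1\<^sub>m n" using XHX X H by (simp add: assoc_mult_mat[of _ n n _ n _ n])
  then show "H * X * X\<^sup>T = 1\<^sub>m n" using mat_mult_left_right_inverse[of "X\<^sup>T" n "H * X"] X H by simp
  show "X * (X\<^sup>T * H) = 1\<^sub>m n"
    using mat_mult_left_right_inverse[of "X\<^sup>T * H" n X] X H XHX by simp
qed

lemma minv_H: "minv n H = X * X\<^sup>T"
  using HX_inverse H X by (intro minvI) (auto simp: assoc_mult_mat[of _ n n _ n _ n])

lemma minv_H_mult_vec:
  assumes "y \<in> carrier_vec n"
  shows "minv n H *\<^sub>v (H *\<^sub>v y) = y"
proof -
  have "minv n H *\<^sub>v (H *\<^sub>v y) = (X * (X\<^sup>T * H)) *\<^sub>v y"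
    unfolding minv_H using X H assms by (simp add: assoc_mult_mat_vec[of _ n n _ n])
  then show ?thesis using XH_inverse assms by simp
qed

text \<open>The inverse of X applied to y, written through the H-orthonormality of the columns:
  entry j is the H-inner product of y with column j.\<close>

definition coords :: "real vec \<Rightarrow> real vec" where
  "coords y = X\<^sup>T *\<^sub>v (H *\<^sub>v y)"

lemma coords_carrier: "coords y \<in> carrier_vec n"
  unfolding coords_def using X by (intro carrier_vecI) simp

lemma X_coords:
  assumes "y \<in> carrier_vec n"
  shows "X *\<^sub>v coords y = y"
proof -
  have "X *\<^sub>v coords y = (X * (X\<^sup>T * H)) *\<^sub>v y"
    unfolding coords_def using X H assms by (simp add: assoc_mult_mat_vec[of _ n n _ n])
  then show ?thesis using XH_inverse assms by simp
qed

lemma X_isometry: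
  assumes "z \<in> carrier_vec n" "z' \<in> carrier_vec n"
  shows "(X *\<^sub>v z) \<bullet> (H *\<^sub>v (X *\<^sub>v z')) = z \<bullet> z'"
proof -
  have "(X *\<^sub>v z) \<bullet> (H *\<^sub>v (X *\<^sub>v z')) = z \<bullet> (X\<^sup>T *\<^sub>v (H *\<^sub>v (X *\<^sub>v z')))"
    using mult_mat_vec_adjoint[of "X\<^sup>T" n n z "H *\<^sub>v (X *\<^sub>v z')"] X H assms by simp
  also have "X\<^sup>T *\<^sub>v (H *\<^sub>v (X *\<^sub>v z')) = (X\<^sup>T * H * X) *\<^sub>v z'"
    using X H assms by (simp add: assoc_mult_mat_vec[of _ n n _ n] mult_carrier_mat[of _ n n])
  finally show ?thesis unfolding XHX using assms by simp
qed

lemma H_pos_def: "pos_def_mat n H"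
  unfolding pos_def_mat_def sym_mat_def
proof (intro conjI ballI impI)
  fix y :: "real vec" assume y: "y \<in> carrier_vec n" "y \<noteq> 0\<^sub>v n"
  have "coords y \<noteq> 0\<^sub>v n" using X_coords[OF y(1)] y(2) mult_mat_zero_vec[OF X] by metis
  then have "0 < coords y \<bullet> coords y" using scalar_prod_self_pos coords_carrier by blast
  then show "0 < y \<bullet> (H *\<^sub>v y)"
    using X_isometry[OF coords_carrier coords_carrier, of y y] X_coords[OF y(1)] by simp
qed (rule H H_sym)+

lemma H_quad_nonneg: "y \<in> carrier_vec n \<Longrightarrow> 0 \<le> y \<bullet> (H *\<^sub>v y)"
  by (simp add: H_quad)

section \<open>Exact singular vectors and first-order perturbation\<close>

lemma col_X: "i < n \<Longrightarrow> col X i = X *\<^sub>v unit_vec n i"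
  using X by (intro eq_vecI) auto

lemma col_X_carrier: "col X i \<in> carrier_vec n"
  using X by (intro carrier_vecI) simp

lemma col_X_unit: "i < n \<Longrightarrow> col X i \<bullet> (H *\<^sub>v col X i) = 1"
  by (simp add: col_X X_isometry)

lemma gram_eigenvector:
  assumes i: "i < n"
  shows "A\<^sup>T *\<^sub>v (A *\<^sub>v col X i) = (c i)\<^sup>2 \<cdot>\<^sub>v (H *\<^sub>v col X i)"
proof -
  let ?D = "mat_diag n (\<lambda>i. (c i)\<^sup>2)"
  have "A\<^sup>T * A * X = (H * X * X\<^sup>T) * (A\<^sup>T * A * X)"
    unfolding HX_inverse using A X by (simp add: left_mult_one_mat[of _ n n])
  also have "\<dots> = H * X * (X\<^sup>T * (A\<^sup>T * A) * X)"
    using A X H by (simp add: assoc_mult_mat[of _ n n _ n _ n] mult_carrier_mat[of _ n n]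
        mult_carrier_mat[of _ n m1])
  finally have eq: "A\<^sup>T * A * X = H * X * ?D" unfolding XAX .
  have e: "unit_vec n i \<in> carrier_vec n" by simp
  have "A\<^sup>T *\<^sub>v (A *\<^sub>v col X i) = (A\<^sup>T * A * X) *\<^sub>v unit_vec n i"
    unfolding col_X[OF i] using A X
    by (simp add: assoc_mult_mat_vec[of _ n n _ n] assoc_mult_mat_vec[of _ n m1 _ n]
        mult_carrier_mat[of _ n m1])
  also have "\<dots> = H *\<^sub>v (X *\<^sub>v (?D *\<^sub>v unit_vec n i))"
    unfolding eq using H X
    by (simp add: assoc_mult_mat_vec[of _ n n _ n] mult_carrier_mat[of _ n n] mult_mat_vec_carrier[of _ n n])
  also have "?D *\<^sub>v unit_vec n i = (c i)\<^sup>2 \<cdot>\<^sub>v unit_vec n i"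
    unfolding mat_diag_mult_vec[OF e] using i by (intro eq_vecI) auto
  finally show ?thesis
    unfolding col_X[OF i] using H X e by (simp add: mult_mat_vec[of _ n n] mult_mat_vec_carrier[of _ n n])
qed

text \<open>The orthogonal factor \<open>U\<^sup>T\<close> preserves Euclidean length, and X turns
  the Euclidean length of the coordinates into the H-length of y. Instantiated with A and with B,
  this produces the constants \<open>opnorm SA\<close> and \<open>opnorm SB\<close>.\<close>

lemma vnorm_mult_le_opnorm:
  assumes C: "C \<in> carrier_mat m n" and U: "U \<in> carrier_mat m m" "U\<^sup>T * U = 1\<^sub>m m"
    and y: "y \<in> carrier_vec n"
  shows "vnorm (C *\<^sub>v y) \<le> opnorm (U\<^sup>T * C * X) * sqrt (y \<bullet> (H *\<^sub>v y))"
proof -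
  let ?z = "coords y"
  have UU: "U * U\<^sup>T = 1\<^sub>m m" using mat_mult_left_right_inverse[of "U\<^sup>T" m U] U by simp
  have z: "?z \<in> carrier_vec n" by (rule coords_carrier)
  have Cy: "C *\<^sub>v y \<in> carrier_vec m" using C y by simp
  have "(U\<^sup>T *\<^sub>v (C *\<^sub>v y)) \<bullet> (U\<^sup>T *\<^sub>v (C *\<^sub>v y)) = (C *\<^sub>v y) \<bullet> ((U * U\<^sup>T) *\<^sub>v (C *\<^sub>v y))"
    using U Cy mult_mat_vec_adjoint[of U m m "C *\<^sub>v y" "U\<^sup>T *\<^sub>v (C *\<^sub>v y)"]
    by (simp add: assoc_mult_mat_vec[of _ m m _ m])
  then have "vnorm (C *\<^sub>v y) = vnorm (U\<^sup>T *\<^sub>v (C *\<^sub>v y))"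
    unfolding vnorm_def UU using Cy by simp
  also have "U\<^sup>T *\<^sub>v (C *\<^sub>v y) = (U\<^sup>T * C * X) *\<^sub>v ?z"
    using U C X z X_coords[OF y]
    by (simp add: assoc_mult_mat_vec[of _ m n _ n] assoc_mult_mat_vec[of _ m m _ n]
        mult_carrier_mat[of _ m m])
  also have "vnorm \<dots> \<le> opnorm (U\<^sup>T * C * X) * vnorm ?z"
    using U C X z by (intro vnorm_mult_mat_vec_le[of _ m n]) (auto simp: mult_carrier_mat[of _ m m])
  also have "vnorm ?z = sqrt (y \<bullet> (H *\<^sub>v y))"
    unfolding vnorm_def using X_isometry[OF z z] X_coords[OF y] by simp
  finally show ?thesis .
qed

lemma H_component_split:
  assumes i: "i < n" and y: "y \<in> carrier_vec n" "y \<bullet> (H *\<^sub>v y) = 1"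
  defines "t \<equiv> y \<bullet> (H *\<^sub>v col X i)"
  defines "e \<equiv> y - t \<cdot>\<^sub>v col X i"
  shows "e \<in> carrier_vec n" "e \<bullet> (H *\<^sub>v e) = 1 - t\<^sup>2" "e \<bullet> (H *\<^sub>v col X i) = 0"
    "sinH H y (col X i) = sqrt (1 - t\<^sup>2)" "0 \<le> 1 - t\<^sup>2"
proof -
  let ?x = "col X i"
  have x: "?x \<in> carrier_vec n" by (rule col_X_carrier)
  have Hc: "H *\<^sub>v y \<in> carrier_vec n" "H *\<^sub>v ?x \<in> carrier_vec n" using H x y by auto
  show e: "e \<in> carrier_vec n" using x y by (simp add: e_def)
  show ex: "e \<bullet> (H *\<^sub>v ?x) = 0"
    unfolding e_def using x y Hc
    by (simp add: minus_scalar_prod_distrib[of _ n] col_X_unit[OF i] t_def)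
  have He: "H *\<^sub>v e = H *\<^sub>v y - t \<cdot>\<^sub>v (H *\<^sub>v ?x)"
    unfolding e_def using H x y by (simp add: mult_minus_distrib_mat_vec[of _ n n] mult_mat_vec[of _ n n])
  have "e \<bullet> (H *\<^sub>v e) = e \<bullet> (H *\<^sub>v y)"
    unfolding He using e Hc ex by (simp add: scalar_prod_minus_distrib[of _ n])
  also have "\<dots> = 1 - t * (?x \<bullet> (H *\<^sub>v y))"
    unfolding e_def using x y Hc by (simp add: minus_scalar_prod_distrib[of _ n])
  also have "?x \<bullet> (H *\<^sub>v y) = t" unfolding t_def using x y by (intro H_commute) auto
  finally show q: "e \<bullet> (H *\<^sub>v e) = 1 - t\<^sup>2" by (simp add: power2_eq_square)
  show "0 \<le> 1 - t\<^sup>2" using H_quad_nonneg[OF e] q by simp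
  show "sinH H y ?x = sqrt (1 - t\<^sup>2)"
    unfolding sinH_def cosH_def by (simp add: y(2) col_X_unit[OF i] t_def)
qed

text \<open>Removing from y its H-projection on the exact vector leaves e, and C e is a uh minus a
  multiple of u. Its length is at least the distance from a uh to the line of u, which is a times
  the sine sought, and at most K times the H-length of e, which is K times the H-sine.\<close>

lemma sin_angle_image_le:
  assumes i: "i < n" and y: "y \<in> carrier_vec n" "y \<bullet> (H *\<^sub>v y) = 1"
    and C: "C \<in> carrier_mat m n"
    and K: "\<And>w. w \<in> carrier_vec n \<Longrightarrow> vnorm (C *\<^sub>v w) \<le> K * sqrt (w \<bullet> (H *\<^sub>v w))"
    and uh: "uh \<in> carrier_vec m" "uh \<bullet> uh = 1" and u: "u \<in> carrier_vec m" "u \<bullet> u = 1"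
    and Cy: "C *\<^sub>v y = a \<cdot>\<^sub>v uh" and Cx: "C *\<^sub>v col X i = b \<cdot>\<^sub>v u" and a: "0 < a"
  shows "sin_angle uh u \<le> K / a * sinH H y (col X i)"
proof -
  define t where "t = y \<bullet> (H *\<^sub>v col X i)"
  define e where "e = y - t \<cdot>\<^sub>v col X i"
  note split = H_component_split[OF i y, folded t_def, folded e_def]
  have x: "col X i \<in> carrier_vec n" by (rule col_X_carrier)
  define s where "s = t * b / a"
  have ts: "t * b = a * s" using a by (simp add: s_def)
  have Ce: "C *\<^sub>v e = a \<cdot>\<^sub>v uh - (t * b) \<cdot>\<^sub>v u"
    unfolding e_def using C x y u
    by (simp add: mult_minus_distrib_mat_vec[of _ m n] mult_mat_vec[of _ m n] Cy Cx smult_smult_assoc)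
  have "(C *\<^sub>v e) \<bullet> (C *\<^sub>v e) = a * a - 2 * a * (t * b) * (uh \<bullet> u) + (t * b) * (t * b)"
    unfolding Ce using uh u
    by (simp add: minus_scalar_prod_distrib[of _ m] scalar_prod_minus_distrib[of _ m]
        comm_scalar_prod[of u m uh] algebra_simps)
  \<comment> \<open>Completing the square separates the part of \<open>a \<cdot>\<^sub>v uh\<close>
    orthogonal to u; the component along u can only lengthen the vector.\<close>
  also have "\<dots> = a\<^sup>2 * ((1 - (uh \<bullet> u)\<^sup>2) + (s - uh \<bullet> u)\<^sup>2)"
    unfolding ts by (simp add: power2_eq_square algebra_simps)
  finally have "a\<^sup>2 * (1 - (uh \<bullet> u)\<^sup>2) \<le> (C *\<^sub>v e) \<bullet> (C *\<^sub>v e)"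
    using a by (simp add: mult_left_mono)
  then have "sqrt (a\<^sup>2 * (1 - (uh \<bullet> u)\<^sup>2)) \<le> vnorm (C *\<^sub>v e)"
    unfolding vnorm_def by (rule real_sqrt_le_mono)
  also have "\<dots> \<le> K * sinH H y (col X i)" using K[OF split(1)] split(2,4) by simp
  finally have "a * sqrt (1 - (uh \<bullet> u)\<^sup>2) \<le> K * sinH H y (col X i)"
    using a by (simp add: real_sqrt_mult)
  moreover have "sin_angle uh u = sqrt (1 - (uh \<bullet> u)\<^sup>2)"
    unfolding sin_angle_def vnorm_def using uh u by simp
  ultimately show ?thesis using a by (simp add: field_simps)
qed

text \<open>The error component e is H-orthogonal to \<open>col X i\<close>, and
  \<open>A\<^sup>T * A\<close> maps that vector to a multiple of its image under H. The mixed term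
  therefore vanishes and only terms quadratic in the error survive.\<close>

lemma rayleigh_quotient_error:
  assumes i: "i < n" and y: "y \<in> carrier_vec n" "y \<bullet> (H *\<^sub>v y) = 1" and c1: "(c i)\<^sup>2 \<le> 1"
  shows "\<bar>(vnorm (A *\<^sub>v y))\<^sup>2 - (c i)\<^sup>2\<bar> \<le> (sinH H y (col X i))\<^sup>2"
proof -
  let ?x = "col X i"
  define t where "t = y \<bullet> (H *\<^sub>v ?x)"
  define e where "e = y - t \<cdot>\<^sub>v ?x"
  note split = H_component_split[OF i y, folded t_def, folded e_def]
  have x: "?x \<in> carrier_vec n" by (rule col_X_carrier)
  have Ac: "A *\<^sub>v e \<in> carrier_vec m1" "A *\<^sub>v ?x \<in> carrier_vec m1" using A x split(1) by auto
  have cross: "w \<bullet> (A\<^sup>T *\<^sub>v (A *\<^sub>v ?x)) = (A *\<^sub>v w) \<bullet> (A *\<^sub>v ?x)" if "w \<in> carrier_vec n" for w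
    using mult_mat_vec_adjoint[of "A\<^sup>T" n m1 w "A *\<^sub>v ?x"] A that Ac by simp
  have ex: "(A *\<^sub>v e) \<bullet> (A *\<^sub>v ?x) = 0"
    using cross[OF split(1)] gram_eigenvector[OF i] split(1,3) H x by simp
  have xx: "(A *\<^sub>v ?x) \<bullet> (A *\<^sub>v ?x) = (c i)\<^sup>2"
    using cross[OF x] gram_eigenvector[OF i] H x col_X_unit[OF i] by simp
  have "y = e + t \<cdot>\<^sub>v ?x" unfolding e_def using x y X by (intro eq_vecI) auto
  then have "A *\<^sub>v y = A *\<^sub>v e + t \<cdot>\<^sub>v (A *\<^sub>v ?x)"
    using A split(1) x by (simp add: mult_add_distrib_mat_vec[of _ m1 n] mult_mat_vec[of _ m1 n])
  then have "(vnorm (A *\<^sub>v y))\<^sup>2 = (vnorm (A *\<^sub>v e))\<^sup>2 + t\<^sup>2 * (c i)\<^sup>2"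
    unfolding vnorm_square using Ac ex xx
    by (simp add: add_scalar_prod_distrib[of _ m1] scalar_prod_add_distrib[of _ m1]
        comm_scalar_prod[of "A *\<^sub>v ?x" m1 "A *\<^sub>v e"] power2_eq_square)
  then have "(vnorm (A *\<^sub>v y))\<^sup>2 - (c i)\<^sup>2 = (vnorm (A *\<^sub>v e))\<^sup>2 - (1 - t\<^sup>2) * (c i)\<^sup>2"
    by (simp add: algebra_simps)
  \<comment> \<open>Both terms of the difference lie in [0, 1 - t^2], so it is bounded by 1 - t^2
    itself and not by twice that.\<close>
  moreover have "0 \<le> (vnorm (A *\<^sub>v e))\<^sup>2" "(vnorm (A *\<^sub>v e))\<^sup>2 \<le> 1 - t\<^sup>2"
    using H_quad[OF split(1)] split(2) zero_le_power2[of "vnorm (B *\<^sub>v e)"] by (simp, linarith)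
  moreover have "0 \<le> (1 - t\<^sup>2) * (c i)\<^sup>2" "(1 - t\<^sup>2) * (c i)\<^sup>2 \<le> 1 - t\<^sup>2"
    using split(5) c1 by (auto intro: mult_left_le)
  ultimately show ?thesis unfolding split(4) real_sqrt_pow2[OF split(5)] by linarith
qed

end

text \<open>With p = s^2 the squared ratio is (1 - p) / p, and p^2 + (1 - p)^2 is at least 1/2. Each
  root in the chordal denominator is therefore at least 1 / (p sqrt 2), and the two factors sqrt 2
  make the constant 2.\<close>

lemma chordal_square_ratio_le:
  assumes "0 < s" "0 < s'" "c\<^sup>2 + s\<^sup>2 = 1" "c'\<^sup>2 + s'\<^sup>2 = 1"
  shows "chordal ((c / s)\<^sup>2) ((c' / s')\<^sup>2) \<le> 2 * \<bar>c\<^sup>2 - c'\<^sup>2\<bar>"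
proof -
  define p where "p = s\<^sup>2"
  define p' where "p' = s'\<^sup>2"
  have pos: "0 < p" "0 < p'" using assms by (auto simp: p_def p'_def)
  have cc: "c\<^sup>2 = 1 - p" "c'\<^sup>2 = 1 - p'" using assms by (auto simp: p_def p'_def)
  have den: "1 / (p * sqrt 2) \<le> sqrt (1 + ((1 - p) / p)\<^sup>2)" if "0 < p" for p :: real
  proof (rule real_le_rsqrt)
    have "0 \<le> (2 * p - 1)\<^sup>2" by simp
    then have "1 \<le> 2 * (p\<^sup>2 + (1 - p)\<^sup>2)" by (simp add: power2_eq_square algebra_simps)
    then show "(1 / (p * sqrt 2))\<^sup>2 \<le> 1 + ((1 - p) / p)\<^sup>2"
      using that by (simp add: power_divide power_mult_distrib field_simps)
  qed
  have "chordal ((c / s)\<^sup>2) ((c' / s')\<^sup>2)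
      = \<bar>(1 - p) / p - (1 - p') / p'\<bar> / (sqrt (1 + ((1 - p) / p)\<^sup>2) * sqrt (1 + ((1 - p') / p')\<^sup>2))"
    unfolding chordal_def power_divide[of c] power_divide[of c'] cc p_def[symmetric] p'_def[symmetric] ..
  also have "\<dots> \<le> \<bar>(1 - p) / p - (1 - p') / p'\<bar> / (1 / (p * sqrt 2) * (1 / (p' * sqrt 2)))"
    using pos by (intro divide_left_mono mult_mono den mult_pos_pos) (auto simp: add_pos_nonneg)
  also have "\<dots> = 2 * (\<bar>(1 - p) / p - (1 - p') / p'\<bar> * \<bar>p * p'\<bar>)" using pos by simp
  also have "\<bar>(1 - p) / p - (1 - p') / p'\<bar> * \<bar>p * p'\<bar> = \<bar>c\<^sup>2 - c'\<^sup>2\<bar>"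
  proof -
    have "((1 - p) / p - (1 - p') / p') * (p * p') = (1 - p) - (1 - p')"
      using pos by (simp add: field_simps)
    then show ?thesis unfolding abs_mult[symmetric] cc by (simp only:)
  qed
  finally show ?thesis .
qed

section \<open>The Rayleigh--Ritz approximation\<close>

context gsvd_pair
begin

lemma ritz_block_isometry:
  assumes Y: "Y \<in> carrier_mat n p" "Y\<^sup>T * H * Y = 1\<^sub>m p"
    and a: "a \<in> carrier_vec p" and b: "b \<in> carrier_vec p"
  shows "(Y *\<^sub>v a) \<bullet> (H *\<^sub>v (Y *\<^sub>v b)) = a \<bullet> b"
proof -
  have "(Y *\<^sub>v a) \<bullet> (H *\<^sub>v (Y *\<^sub>v b)) = a \<bullet> (Y\<^sup>T *\<^sub>v (H *\<^sub>v (Y *\<^sub>v b)))"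
    using mult_mat_vec_adjoint[of "Y\<^sup>T" p n a "H *\<^sub>v (Y *\<^sub>v b)"] Y H a b
    by (simp add: mult_mat_vec_carrier[of _ n n])
  also have "Y\<^sup>T *\<^sub>v (H *\<^sub>v (Y *\<^sub>v b)) = (Y\<^sup>T * H * Y) *\<^sub>v b"
    using Y(1) H b by (simp add: assoc_mult_mat_vec[of _ p n _ n] assoc_mult_mat_vec[of _ p n _ p]
        mult_carrier_mat[of _ p n])
  finally show ?thesis unfolding Y(2) using b by simp
qed

text \<open>Pythagoras in the H-inner product: q holds the coefficients of the projection of the
  exact vector on the Ritz space. Taking a = q gives the squared distance to that space; a general a
  shows that every other approximation is at least as far away.\<close>

lemma ritz_residual:
  assumes Y: "Y \<in> carrier_mat n p" "Y\<^sup>T * H * Y = 1\<^sub>m p" and i: "i < n"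
    and a: "a \<in> carrier_vec p"
  defines "q \<equiv> Y\<^sup>T *\<^sub>v (H *\<^sub>v col X i)"
  shows "(col X i - Y *\<^sub>v a) \<bullet> (H *\<^sub>v (col X i - Y *\<^sub>v a)) = 1 - q \<bullet> q + (a - q) \<bullet> (a - q)"
proof -
  let ?x = "col X i"
  have x: "?x \<in> carrier_vec n" by (rule col_X_carrier)
  have Ya: "Y *\<^sub>v a \<in> carrier_vec n" using Y a by simp
  have q: "q \<in> carrier_vec p" unfolding q_def using Y by (intro carrier_vecI) simp
  have c: "H *\<^sub>v ?x \<in> carrier_vec n" "H *\<^sub>v (Y *\<^sub>v a) \<in> carrier_vec n" using H x Ya by auto
  have "(Y *\<^sub>v a) \<bullet> (H *\<^sub>v ?x) = a \<bullet> q"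
    unfolding q_def using mult_mat_vec_adjoint[of "Y\<^sup>T" p n a "H *\<^sub>v ?x"] Y a c by simp
  moreover have "?x \<bullet> (H *\<^sub>v (Y *\<^sub>v a)) = (Y *\<^sub>v a) \<bullet> (H *\<^sub>v ?x)"
    using x Ya by (rule H_commute)
  ultimately have "(?x - Y *\<^sub>v a) \<bullet> (H *\<^sub>v (?x - Y *\<^sub>v a)) = 1 - 2 * (a \<bullet> q) + a \<bullet> a"
    using x Ya c H ritz_block_isometry[OF Y a a] col_X_unit[OF i]
    by (simp add: mult_minus_distrib_mat_vec[of _ n n] minus_scalar_prod_distrib[of _ n]
        scalar_prod_minus_distrib[of _ n])
  moreover have "(a - q) \<bullet> (a - q) = a \<bullet> a - 2 * (a \<bullet> q) + q \<bullet> q"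
    using a q by (simp add: minus_scalar_prod_distrib[of _ p] scalar_prod_minus_distrib[of _ p]
        comm_scalar_prod[of q p a])
  ultimately show ?thesis by simp
qed

text \<open>Saad's argument: the projected operator sends the residual of the exact vector to the
  combination of Ritz vectors with coefficients \<open>(c\<^sub>i\<^sup>2 - d\<^sub>j\<^sup>2) q\<^sub>j\<close>, so the coupling norm controls
  every Ritz coefficient except the \<open>i\<close>-th.\<close>

lemma ritz_coupling_bound:
  assumes Y: "Y \<in> carrier_mat n p" "Y\<^sup>T * H * Y = 1\<^sub>m p"
    and YAY: "Y\<^sup>T * (A\<^sup>T * A) * Y = mat_diag p (\<lambda>j. (d j)\<^sup>2)" and i: "i < n"
  defines "K \<equiv> msqrt n H"
  defines "P \<equiv> orth_proj n (K * Y)"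
  defines "b \<equiv> opnorm (P * minv n K * A\<^sup>T * A * minv n K * (1\<^sub>m n - P))"
  defines "q \<equiv> Y\<^sup>T *\<^sub>v (H *\<^sub>v col X i)"
  shows "(\<Sum>j = 0..<p. (((c i)\<^sup>2 - (d j)\<^sup>2) * q $ j)\<^sup>2) \<le> b\<^sup>2 * (1 - q \<bullet> q)"
proof -
  let ?x = "col X i"
  have x: "?x \<in> carrier_vec n" by (rule col_X_carrier)
  have q: "q \<in> carrier_vec p" unfolding q_def using Y by (intro carrier_vecI) simp
  have K: "K \<in> carrier_mat n n" "K\<^sup>T = K" "K * K = H"
    using msqrt_correct[OF H_pos_def] unfolding K_def pos_def_mat_def sym_mat_def by auto
  \<comment> \<open>The inverse of the root is the root times the inverse of H, and the latter is
    \<open>X * X\<^sup>T\<close>.\<close>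
  define L where "L = K * (X * X\<^sup>T)"
  have L: "L \<in> carrier_mat n n" using K X by (simp add: L_def)
  have KL: "K * L = 1\<^sub>m n"
  proof -
    have "K * L = K * K * (X * X\<^sup>T)" unfolding L_def using K(1) X by (intro assoc_mult_mat[symmetric]) auto
    also have "\<dots> = H * X * X\<^sup>T" unfolding K(3) using H X by (intro assoc_mult_mat[symmetric]) auto
    finally show ?thesis unfolding HX_inverse .
  qed
  have LK: "L * K = 1\<^sub>m n" using mat_mult_left_right_inverse[OF K(1) L KL] .
  have minvK: "minv n K = L" using minvI[OF K(1) L KL] .
  define W where "W = K * Y"
  have W: "W \<in> carrier_mat n p" using K Y by (simp add: W_def)
  have WT: "W\<^sup>T = Y\<^sup>T * K" unfolding W_def using K Y by (simp add: transpose_mult[of _ n n _ p])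
  have "Y\<^sup>T * K * (K * Y) = Y\<^sup>T * (K * K) * Y"
    using K(1) Y(1) by (simp add: assoc_mult_mat[of _ p n _ n _ p] assoc_mult_mat[of _ p n _ n _ n]
        assoc_mult_mat[of _ n n _ n _ p] mult_carrier_mat[of _ n n])
  then have WW: "W\<^sup>T * W = 1\<^sub>m p" unfolding WT unfolding W_def K(3) Y(2) .
  have P: "P = W * W\<^sup>T" unfolding P_def W_def[symmetric] by (rule orth_proj_eq[OF W WW])
  have Pc: "P \<in> carrier_mat n n" unfolding P using W by simp
  have KKv: "K *\<^sub>v (K *\<^sub>v w) = H *\<^sub>v w" if "w \<in> carrier_vec n" for w
    using K that by (simp add: assoc_mult_mat_vec[symmetric, of _ n n _ n])
  have LKv: "L *\<^sub>v (K *\<^sub>v w) = w" and KLv: "K *\<^sub>v (L *\<^sub>v w) = w" if "w \<in> carrier_vec n" for w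
    using K L that LK KL by (simp_all add: assoc_mult_mat_vec[symmetric, of _ n n _ n])
  define e where "e = ?x - Y *\<^sub>v q"
  define z where "z = K *\<^sub>v e"
  have Yq: "Y *\<^sub>v q \<in> carrier_vec n" using Y q by simp
  have e: "e \<in> carrier_vec n" using x Yq by (simp add: e_def)
  have z: "z \<in> carrier_vec n" using K e by (simp add: z_def)
  have zz: "z \<bullet> z = 1 - q \<bullet> q"
  proof -
    have "z \<bullet> z = e \<bullet> (H *\<^sub>v e)"
      using mult_mat_vec_adjoint[OF K(1) e z] K e by (simp add: z_def KKv)
    also have "\<dots> = 1 - q \<bullet> q + (q - q) \<bullet> (q - q)"
      unfolding e_def by (rule ritz_residual[OF Y i q, folded q_def])
    finally show ?thesis using q by simp
  qed
  have YHYq: "Y\<^sup>T *\<^sub>v (H *\<^sub>v (Y *\<^sub>v q)) = q"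
  proof -
    have "Y\<^sup>T *\<^sub>v (H *\<^sub>v (Y *\<^sub>v q)) = (Y\<^sup>T * H * Y) *\<^sub>v q"
      using Y(1) H q by (simp add: assoc_mult_mat_vec[of _ p n _ n] assoc_mult_mat_vec[of _ p n _ p]
          mult_carrier_mat[of _ p n])
    then show ?thesis unfolding Y(2) using q by simp
  qed
  have "Y\<^sup>T *\<^sub>v (H *\<^sub>v e) = q - q"
    unfolding e_def using Y H x Yq YHYq
    by (simp add: mult_minus_distrib_mat_vec[of _ n n] mult_minus_distrib_mat_vec[of _ p n] q_def)
  \<comment> \<open>The residual z is orthogonal to the range of P, so
    \<open>1\<^sub>m n - P\<close> fixes it and the full coupling matrix can be tested on
    it.\<close>
  then have WTz: "W\<^sup>T *\<^sub>v z = 0\<^sub>v p"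
    unfolding WT z_def using Y K e q by (simp add: assoc_mult_mat_vec[of _ p n _ n] KKv)
  have Pz: "P *\<^sub>v z = 0\<^sub>v n"
    unfolding P using W z mult_mat_zero_vec[OF W] by (simp add: assoc_mult_mat_vec[of _ n p _ n] WTz)
  have IPz: "(1\<^sub>m n - P) *\<^sub>v z = z"
    using Pc z by (simp add: minus_mult_distrib_mat_vec[of _ n n] Pz)
  have AAe: "A\<^sup>T *\<^sub>v (A *\<^sub>v e) = (c i)\<^sup>2 \<cdot>\<^sub>v (H *\<^sub>v ?x) - A\<^sup>T *\<^sub>v (A *\<^sub>v (Y *\<^sub>v q))"
    unfolding e_def using A x Yq
    by (simp add: mult_minus_distrib_mat_vec[of _ m1 n] mult_minus_distrib_mat_vec[of _ n m1]
        gram_eigenvector[OF i] mult_mat_vec_carrier[of _ m1 n])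
  have YAAq: "Y\<^sup>T *\<^sub>v (A\<^sup>T *\<^sub>v (A *\<^sub>v (Y *\<^sub>v q))) = vec p (\<lambda>j. (d j)\<^sup>2 * q $ j)"
  proof -
    have "Y\<^sup>T *\<^sub>v (A\<^sup>T *\<^sub>v (A *\<^sub>v (Y *\<^sub>v q))) = (Y\<^sup>T * (A\<^sup>T * A) * Y) *\<^sub>v q"
      using Y A q by (simp add: assoc_mult_mat_vec[of _ p n _ n] assoc_mult_mat_vec[of _ p n _ p]
          assoc_mult_mat_vec[of _ n m1 _ n] mult_carrier_mat[of _ p n])
    then show ?thesis unfolding YAY using q by (simp add: mat_diag_mult_vec)
  qed
  define h where "h = vec p (\<lambda>j. ((c i)\<^sup>2 - (d j)\<^sup>2) * q $ j)"
  have h: "h \<in> carrier_vec p" by (simp add: h_def)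
  have "Y\<^sup>T *\<^sub>v (A\<^sup>T *\<^sub>v (A *\<^sub>v e)) = (c i)\<^sup>2 \<cdot>\<^sub>v q - vec p (\<lambda>j. (d j)\<^sup>2 * q $ j)"
    unfolding AAe using Y A H x Yq YAAq
    by (simp add: mult_minus_distrib_mat_vec[of _ p n] mult_mat_vec[of _ p n] q_def
        mult_mat_vec_carrier[of _ n m1] mult_mat_vec_carrier[of _ n n])
  also have "\<dots> = h" unfolding h_def using q by (intro eq_vecI) (auto simp: algebra_simps)
  finally have YAAe: "Y\<^sup>T *\<^sub>v (A\<^sup>T *\<^sub>v (A *\<^sub>v e)) = h" .
  let ?M = "P * L * A\<^sup>T * A * L * (1\<^sub>m n - P)"
  have M: "?M \<in> carrier_mat n n" using Pc L A by (intro carrier_matI) auto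
  have AAec: "A\<^sup>T *\<^sub>v (A *\<^sub>v e) \<in> carrier_vec n" using A e by simp
  have AT: "A\<^sup>T \<in> carrier_mat n m1" and Ae: "A *\<^sub>v e \<in> carrier_vec m1" using A e by auto
  have pre: "P * L \<in> carrier_mat n n" "P * L * A\<^sup>T \<in> carrier_mat n m1"
      "P * L * A\<^sup>T * A \<in> carrier_mat n n" "P * L * A\<^sup>T * A * L \<in> carrier_mat n n"
      "1\<^sub>m n - P \<in> carrier_mat n n"
    using Pc L A by (auto intro!: carrier_matI)
  have Lz: "L *\<^sub>v z = e" unfolding z_def by (rule LKv[OF e])
  have "?M *\<^sub>v z = P *\<^sub>v (L *\<^sub>v (A\<^sup>T *\<^sub>v (A *\<^sub>v e)))"
    unfolding assoc_mult_mat_vec[OF pre(4,5) z] IPz assoc_mult_mat_vec[OF pre(3) L z] Lz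
      assoc_mult_mat_vec[OF pre(2) A e] assoc_mult_mat_vec[OF pre(1) AT Ae]
    by (rule assoc_mult_mat_vec[OF Pc L AAec])
  also have "\<dots> = W *\<^sub>v (Y\<^sup>T *\<^sub>v (K *\<^sub>v (L *\<^sub>v (A\<^sup>T *\<^sub>v (A *\<^sub>v e)))))"
    unfolding P WT using W Y K L AAec
    by (simp add: assoc_mult_mat_vec[of _ n p _ n] assoc_mult_mat_vec[of _ p n _ n]
        mult_mat_vec_carrier[of _ n n])
  also have "\<dots> = W *\<^sub>v h" unfolding KLv[OF AAec] YAAe ..
  finally have Mz: "?M *\<^sub>v z = W *\<^sub>v h" .
  have "(W *\<^sub>v h) \<bullet> (W *\<^sub>v h) = h \<bullet> (W\<^sup>T *\<^sub>v (W *\<^sub>v h))"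
    using mult_mat_vec_adjoint[of "W\<^sup>T" p n h "W *\<^sub>v h"] W h by simp
  also have "W\<^sup>T *\<^sub>v (W *\<^sub>v h) = h" using W h WW by (simp add: assoc_mult_mat_vec[symmetric, of _ p n _ p])
  finally have "h \<bullet> h = (vnorm (?M *\<^sub>v z))\<^sup>2" unfolding Mz vnorm_square by simp
  also have "\<dots> \<le> (opnorm ?M * vnorm z)\<^sup>2"
    using vnorm_mult_mat_vec_le[OF M z] vnorm_nonneg by (intro power_mono) auto
  also have "\<dots> = b\<^sup>2 * (1 - q \<bullet> q)" unfolding power_mult_distrib vnorm_square zz b_def minvK ..
  finally show ?thesis by (simp add: h_def scalar_prod_def power2_eq_square)
qed

text \<open>The squared sine is N + rest: N is the squared distance to the Ritz space, and rest is
  the part of the projection that falls on the wrong Ritz vectors. The coupling bound, with every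
  gap at least \<delta>, limits rest to b^2 / \<delta>^2 times N. Finally N is at most the squared
  residual of any candidate in the Ritz space, which is how the vector a enters.\<close>

lemma sinH_ritz_le:
  assumes Y: "Y \<in> carrier_mat n p" "Y\<^sup>T * H * Y = 1\<^sub>m p"
    and YAY: "Y\<^sup>T * (A\<^sup>T * A) * Y = mat_diag p (\<lambda>j. (d j)\<^sup>2)" and i: "i < n" "i < p"
    and a: "a \<in> carrier_vec p"
  defines "K \<equiv> msqrt n H"
  defines "P \<equiv> orth_proj n (K * Y)"
  defines "b \<equiv> opnorm (P * minv n K * A\<^sup>T * A * minv n K * (1\<^sub>m n - P))"
  defines "G \<equiv> {\<bar>(c i)\<^sup>2 - (d j)\<^sup>2\<bar> | j. j < p \<and> j \<noteq> i}"
  assumes G: "\<forall>g \<in> G. 0 < g"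
  shows "sinH H (col Y i) (col X i)
    \<le> gap_factor b G * sqrt ((col X i - Y *\<^sub>v a) \<bullet> (H *\<^sub>v (col X i - Y *\<^sub>v a)))"
proof -
  let ?x = "col X i"
  define q where "q = Y\<^sup>T *\<^sub>v (H *\<^sub>v ?x)"
  define rest where "rest = (\<Sum>j \<in> {0..<p} - {i}. (q $ j)\<^sup>2)"
  define N where "N = 1 - q \<bullet> q"
  have x: "?x \<in> carrier_vec n" by (rule col_X_carrier)
  have q: "q \<in> carrier_vec p" unfolding q_def using Y by (intro carrier_vecI) simp
  have qq: "q \<bullet> q = (q $ i)\<^sup>2 + rest"
  proof -
    have "q \<bullet> q = (\<Sum>j \<in> {0..<p}. (q $ j)\<^sup>2)" using q by (simp add: scalar_prod_def power2_eq_square)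
    then show ?thesis unfolding rest_def using i by (simp add: sum.remove[of _ i])
  qed
  have coup: "(\<Sum>j = 0..<p. (((c i)\<^sup>2 - (d j)\<^sup>2) * q $ j)\<^sup>2) \<le> b\<^sup>2 * N"
    unfolding N_def b_def P_def K_def q_def by (rule ritz_coupling_bound[OF Y YAY i(1)])
  have res: "N + (a - q) \<bullet> (a - q) = (?x - Y *\<^sub>v a) \<bullet> (H *\<^sub>v (?x - Y *\<^sub>v a))"
    unfolding N_def q_def by (rule ritz_residual[OF Y i(1) a, symmetric])
  have N0: "0 \<le> N"
    using ritz_residual[OF Y i(1) q, folded q_def] H_quad_nonneg[of "?x - Y *\<^sub>v q"] Y q x
    by (simp add: N_def)
  have colY: "col Y i = Y *\<^sub>v unit_vec p i" using Y i by (intro eq_vecI) auto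
  have "col Y i \<bullet> (H *\<^sub>v col Y i) = 1"
    unfolding colY using ritz_block_isometry[OF Y, of "unit_vec p i" "unit_vec p i"] i by simp
  moreover have "col Y i \<bullet> (H *\<^sub>v ?x) = q $ i" unfolding q_def using Y i by simp
  ultimately have "sinH H (col Y i) ?x = sqrt (1 - (q $ i)\<^sup>2)"
    unfolding sinH_def cosH_def col_X_unit[OF i(1)] by simp
  also have "\<dots> = sqrt (N + rest)" unfolding N_def qq by simp
  also have "\<dots> \<le> sqrt ((gap_factor b G)\<^sup>2 * N)"
  proof (rule real_sqrt_le_mono, cases "G = {}")
    \<comment> \<open>No gaps means p = 1, so there is no wrong Ritz vector and the factor 1
      suffices.\<close>
    case True
    then have "{0..<p} - {i} = {}" unfolding G_def by auto
    then have "rest = 0" unfolding rest_def by (simp only: sum.empty)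
    then show "N + rest \<le> (gap_factor b G)\<^sup>2 * N" by (simp add: gap_factor_def True)
  next
    case False
    have "G = (\<lambda>j. \<bar>(c i)\<^sup>2 - (d j)\<^sup>2\<bar>) ` {j. j < p \<and> j \<noteq> i}" unfolding G_def by auto
    then have fin: "finite G" by simp
    define \<delta> where "\<delta> = Min G"
    have \<delta>: "0 < \<delta>" unfolding \<delta>_def using fin False G by simp
    have le: "\<delta> \<le> \<bar>(c i)\<^sup>2 - (d j)\<^sup>2\<bar>" if "j \<in> {0..<p} - {i}" for j
      unfolding \<delta>_def using fin that by (intro Min_le) (auto simp: G_def)
    have "\<delta>\<^sup>2 * rest \<le> (\<Sum>j \<in> {0..<p} - {i}. (((c i)\<^sup>2 - (d j)\<^sup>2) * q $ j)\<^sup>2)"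
      unfolding rest_def sum_distrib_left
    proof (rule sum_mono)
      fix j assume "j \<in> {0..<p} - {i}"
      then have "\<delta>\<^sup>2 \<le> ((c i)\<^sup>2 - (d j)\<^sup>2)\<^sup>2"
        using le[of j] \<delta> by (simp add: abs_le_square_iff[symmetric])
      then show "\<delta>\<^sup>2 * (q $ j)\<^sup>2 \<le> (((c i)\<^sup>2 - (d j)\<^sup>2) * q $ j)\<^sup>2"
        unfolding power_mult_distrib by (intro mult_right_mono) auto
    qed
    also have "\<dots> \<le> (\<Sum>j = 0..<p. (((c i)\<^sup>2 - (d j)\<^sup>2) * q $ j)\<^sup>2)" by (rule sum_mono2) auto
    also note coup
    finally have "rest \<le> b\<^sup>2 * N / \<delta>\<^sup>2" using \<delta> by (simp add: field_simps)
    moreover have "(gap_factor b G)\<^sup>2 = 1 + b\<^sup>2 / \<delta>\<^sup>2"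
      unfolding gap_factor_def \<delta>_def[symmetric] using False by (simp add: add_nonneg_nonneg)
    ultimately show "N + rest \<le> (gap_factor b G)\<^sup>2 * N" by (simp add: algebra_simps)
  qed
  also have "\<dots> = gap_factor b G * sqrt N"
    using N0 by (simp add: real_sqrt_mult gap_factor_def add_nonneg_nonneg)
  also have "\<dots> \<le> gap_factor b G * sqrt ((?x - Y *\<^sub>v a) \<bullet> (H *\<^sub>v (?x - Y *\<^sub>v a)))"
    unfolding res[symmetric] using scalar_prod_self_nonneg[of "a - q"]
    by (intro mult_left_mono real_sqrt_le_mono) (auto simp: gap_factor_def add_nonneg_nonneg)
  finally show ?thesis .
qed

end

section \<open>Filtered subspace iteration\<close>

lemma smult_mat_mult_vec:
  assumes "M \<in> carrier_mat m n" "x \<in> carrier_vec n"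
  shows "(a \<cdot>\<^sub>m M) *\<^sub>v x = a \<cdot>\<^sub>v (M *\<^sub>v (x :: real vec))"
  using assms by (intro eq_vecI) (auto simp: scalar_prod_def sum_distrib_left mult.assoc)

lemma cheb_mat_eigenvector:
  assumes S: "S \<in> carrier_mat n n" and x: "x \<in> carrier_vec n" and ev: "S *\<^sub>v x = \<mu> \<cdot>\<^sub>v x"
  shows "cheb_mat n j S \<in> carrier_mat n n \<and> cheb_mat n j S *\<^sub>v x = cheb j \<mu> \<cdot>\<^sub>v x"
proof (induction j rule: induct_nat_012)
  case (ge2 j)
  let ?T = "cheb_mat n (Suc j) S" and ?T' = "cheb_mat n j S"
  have c: "?T \<in> carrier_mat n n" "?T' \<in> carrier_mat n n" using ge2 by auto
  have sm: "(2 \<cdot>\<^sub>m (S * ?T)) *\<^sub>v x = 2 \<cdot>\<^sub>v ((S * ?T) *\<^sub>v x)"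
    using S c x by (intro smult_mat_mult_vec[of _ n n]) auto
  have "cheb_mat n (Suc (Suc j)) S *\<^sub>v x = 2 \<cdot>\<^sub>v (S *\<^sub>v (?T *\<^sub>v x)) - ?T' *\<^sub>v x"
    using S c x sm
    by (simp add: minus_mult_distrib_mat_vec[of _ n n] assoc_mult_mat_vec[of _ n n _ n] mult_carrier_mat[of _ n n])
  also have "\<dots> = 2 \<cdot>\<^sub>v (cheb (Suc j) \<mu> \<cdot>\<^sub>v (\<mu> \<cdot>\<^sub>v x)) - cheb j \<mu> \<cdot>\<^sub>v x"
    using ge2 S x by (simp add: mult_mat_vec[of _ n n] ev)
  also have "\<dots> = cheb (Suc (Suc j)) \<mu> \<cdot>\<^sub>v x"
    using x by (intro eq_vecI) (auto simp: algebra_simps)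
  finally show ?case using minus_carrier_mat[OF c(2)] by simp
qed (use S x ev in auto)

lemma msum_mult_vec:
  assumes "\<And>j. f j \<in> carrier_mat n n" and "\<And>j. f j *\<^sub>v x = g j \<cdot>\<^sub>v x" and x: "x \<in> carrier_vec n"
  shows "msum n f m \<in> carrier_mat n n \<and> msum n f m *\<^sub>v x = (\<Sum>j<m. g j) \<cdot>\<^sub>v x"
proof (induction m)
  case 0
  then show ?case using x by (auto intro!: eq_vecI)
next
  case (Suc m)
  then show ?case using assms
    by (simp add: add_mult_distrib_mat_vec[of _ n n] add_smult_distrib_vec)
qed

lemma filter_mat_eigenvector:
  assumes S: "S \<in> carrier_mat n n" and x: "x \<in> carrier_vec n" and ev: "S *\<^sub>v x = \<mu> \<cdot>\<^sub>v x"
  shows "filter_mat n cmin cmax d S \<in> carrier_mat n n"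
    and "filter_mat n cmin cmax d S *\<^sub>v x = psi cmin cmax d \<mu> \<cdot>\<^sub>v x"
proof -
  let ?w = "\<lambda>j. rho d j * eta cmin cmax j"
  note T = cheb_mat_eigenvector[OF S x ev]
  have "(?w j \<cdot>\<^sub>m cheb_mat n j S) *\<^sub>v x = (?w j * cheb j \<mu>) \<cdot>\<^sub>v x" for j
  proof -
    have "(?w j \<cdot>\<^sub>m cheb_mat n j S) *\<^sub>v x = ?w j \<cdot>\<^sub>v (cheb_mat n j S *\<^sub>v x)"
      using T[of j] x by (intro smult_mat_mult_vec[of _ n n]) auto
    then show ?thesis using T[of j] by (simp add: smult_smult_assoc)
  qed
  \<comment> \<open>\<open>msum\<close> stops before its last argument, so \<open>Suc d\<close> is
    the count that includes degree d.\<close>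
  then have "filter_mat n cmin cmax d S \<in> carrier_mat n n \<and>
      filter_mat n cmin cmax d S *\<^sub>v x = (\<Sum>j<Suc d. ?w j * cheb j \<mu>) \<cdot>\<^sub>v x"
    unfolding filter_mat_def using T x by (intro msum_mult_vec) auto
  then show "filter_mat n cmin cmax d S \<in> carrier_mat n n"
    and "filter_mat n cmin cmax d S *\<^sub>v x = psi cmin cmax d \<mu> \<cdot>\<^sub>v x"
    unfolding psi_def by (simp_all add: lessThan_Suc_atMost)
qed

lemma lead_cols_transpose_mult_vec:
  assumes "X \<in> carrier_mat n m" "p \<le> m" "y \<in> carrier_vec n" "j < p"
  shows "((lead_cols p X)\<^sup>T *\<^sub>v y) $ j = (X\<^sup>T *\<^sub>v y) $ j"
  using assms by (simp add: lead_cols_def scalar_prod_def)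

lemma trail_cols_transpose_mult_vec:
  assumes "X \<in> carrier_mat n m" "y \<in> carrier_vec n" "j < m - p"
  shows "((trail_cols p X)\<^sup>T *\<^sub>v y) $ j = (X\<^sup>T *\<^sub>v y) $ (j + p)"
  using assms by (simp add: trail_cols_def scalar_prod_def)

context gsvd_pair
begin

text \<open>\<open>A\<^sup>T * A - B\<^sup>T * B\<close> is twice \<open>A\<^sup>T * A\<close> minus
  H, so the generalised eigenvalue c^2 becomes 2 c^2 - 1, which is where \<open>lmap\<close> comes
  from.\<close>

lemma shift_eigenvector:
  assumes i: "i < n"
  shows "(minv n H * (A\<^sup>T * A - B\<^sup>T * B)) *\<^sub>v col X i = lmap (c i) \<cdot>\<^sub>v col X i"
proof -
  let ?x = "col X i"
  have x: "?x \<in> carrier_vec n" by (rule col_X_carrier)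
  have Hx: "H *\<^sub>v ?x \<in> carrier_vec n" using H x by simp
  have m: "minv n H \<in> carrier_mat n n" unfolding minv_H using X by simp
  have a: "A\<^sup>T *\<^sub>v (A *\<^sub>v ?x) \<in> carrier_vec n" "B\<^sup>T *\<^sub>v (B *\<^sub>v ?x) \<in> carrier_vec n"
    using A B x by auto
  have "(A\<^sup>T * A - B\<^sup>T * B) *\<^sub>v ?x = A\<^sup>T *\<^sub>v (A *\<^sub>v ?x) - B\<^sup>T *\<^sub>v (B *\<^sub>v ?x)"
    using A B x by (simp add: minus_mult_distrib_mat_vec[of _ n n] assoc_mult_mat_vec[of _ n m1 _ n]
        assoc_mult_mat_vec[of _ n m2 _ n])
  also have "\<dots> = 2 \<cdot>\<^sub>v (A\<^sup>T *\<^sub>v (A *\<^sub>v ?x)) - H *\<^sub>v ?x"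
    unfolding H_mult_vec[OF x] using a A B by (intro eq_vecI) auto
  also have "\<dots> = lmap (c i) \<cdot>\<^sub>v (H *\<^sub>v ?x)"
    unfolding gram_eigenvector[OF i] lmap_def using Hx by (intro eq_vecI) (auto simp: algebra_simps)
  finally have "(A\<^sup>T * A - B\<^sup>T * B) *\<^sub>v ?x = lmap (c i) \<cdot>\<^sub>v (H *\<^sub>v ?x)" .
  then have "(minv n H * (A\<^sup>T * A - B\<^sup>T * B)) *\<^sub>v ?x = minv n H *\<^sub>v (lmap (c i) \<cdot>\<^sub>v (H *\<^sub>v ?x))"
    using m A B x by (subst assoc_mult_mat_vec[of _ n n _ n]) auto
  then show ?thesis using m Hx minv_H_mult_vec[OF x] by (simp add: mult_mat_vec[of _ n n])
qed

lemma eigen_mult_vec: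
  assumes P: "P \<in> carrier_mat n n" and ev: "\<And>j. j < n \<Longrightarrow> P *\<^sub>v col X j = g j \<cdot>\<^sub>v col X j"
    and h: "h \<in> carrier_vec n"
  shows "P *\<^sub>v (X *\<^sub>v h) = X *\<^sub>v vec n (\<lambda>j. g j * h $ j)"
proof -
  have "P * X = X * mat_diag n g"
  proof (rule mat_col_eqI)
    fix j assume "j < dim_col (X * mat_diag n g)"
    then have j: "j < n" by (simp add: mat_diag_def)
    have "col (X * mat_diag n g) j = g j \<cdot>\<^sub>v col X j"
      unfolding mat_diag_mult_right[OF X] using j X by (intro eq_vecI) auto
    then show "col (P * X) j = col (X * mat_diag n g) j"
      unfolding col_mult2[OF P X j] ev[OF j] by simp
  qed (use P X in \<open>auto simp: mat_diag_def\<close>)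
  then have "P *\<^sub>v (X *\<^sub>v h) = (X * mat_diag n g) *\<^sub>v h"
    using P X h by (simp add: assoc_mult_mat_vec[symmetric, of _ n n _ n])
  then show ?thesis using X h
    by (simp add: assoc_mult_mat_vec[of _ n n _ n] mat_diag_mult_vec)
qed

text \<open>Only the inclusion of the filtered starting space in the current Ritz space is needed, so the
  triangular factors of the iteration may be singular.\<close>

lemma filtered_start_in_ritz_space:
  fixes Xk Q R Xb Xh :: "nat \<Rightarrow> real mat"
  assumes P: "P \<in> carrier_mat n n" and ev: "\<And>j. j < n \<Longrightarrow> P *\<^sub>v col X j = g j \<cdot>\<^sub>v col X j"
    and it: "\<And>k. Q k \<in> carrier_mat n p" "\<And>k. R k \<in> carrier_mat p p" "\<And>k. Xb k \<in> carrier_mat p p"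
      "\<And>k. invertible_mat (Xb k)" "\<And>k. Xk k = Q k * R k" "\<And>k. Xh k = Q k * Xb k"
      "\<And>k. Xk (Suc k) = P * Xh k"
    and h: "h \<in> carrier_vec n" and a: "a \<in> carrier_vec p" and start: "X *\<^sub>v h = Xk 0 *\<^sub>v a"
  shows "\<exists>b \<in> carrier_vec p. X *\<^sub>v vec n (\<lambda>j. g j ^ k * h $ j) = Xh k *\<^sub>v b"
proof -
  have rot: "\<exists>b' \<in> carrier_vec p. Xk k *\<^sub>v b = Xh k *\<^sub>v b'" if b: "b \<in> carrier_vec p" for b k
  proof
    note inv = minv_inverse[OF it(3,4)[of k]]
    \<comment> \<open>The change of basis in X k b = Q R b = Q Xb (Xb^-1 R b): only the
      Rayleigh-Ritz rotation has to be inverted.\<close>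
    let ?b = "minv p (Xb k) *\<^sub>v (R k *\<^sub>v b)"
    have Rb: "R k *\<^sub>v b \<in> carrier_vec p" using it(2)[of k] b by simp
    show b': "?b \<in> carrier_vec p" using inv(1) Rb by simp
    have "Xh k *\<^sub>v ?b = Q k *\<^sub>v (Xb k *\<^sub>v ?b)"
      unfolding it(6) using it(1,3)[of k] b' by (intro assoc_mult_mat_vec) auto
    also have "Xb k *\<^sub>v ?b = (Xb k * minv p (Xb k)) *\<^sub>v (R k *\<^sub>v b)"
      using it(3)[of k] inv(1) Rb by (intro assoc_mult_mat_vec[symmetric]) auto
    also have "\<dots> = R k *\<^sub>v b" unfolding inv(2) using Rb by simp
    also have "Q k *\<^sub>v (R k *\<^sub>v b) = Xk k *\<^sub>v b"
      unfolding it(5) using it(1,2)[of k] b by (intro assoc_mult_mat_vec[symmetric]) auto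
    finally show "Xk k *\<^sub>v b = Xh k *\<^sub>v ?b" by simp
  qed
  show ?thesis
  proof (induction k)
    case 0
    have "vec n (\<lambda>j. g j ^ 0 * h $ j) = h" using h by (intro eq_vecI) auto
    then show ?case using rot[OF a, of 0] start by simp
  next
    case (Suc k)
    then obtain b where b: "b \<in> carrier_vec p" "X *\<^sub>v vec n (\<lambda>j. g j ^ k * h $ j) = Xh k *\<^sub>v b" by blast
    have Xhk: "Xh k \<in> carrier_mat n p" unfolding it(6) using it(1,3)[of k] by simp
    have "vec n (\<lambda>j. g j ^ Suc k * h $ j) = vec n (\<lambda>j. g j * vec n (\<lambda>j. g j ^ k * h $ j) $ j)"
      by (intro eq_vecI) auto
    then have "X *\<^sub>v vec n (\<lambda>j. g j ^ Suc k * h $ j) = P *\<^sub>v (X *\<^sub>v vec n (\<lambda>j. g j ^ k * h $ j))"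
      using eigen_mult_vec[OF P ev, of "vec n (\<lambda>j. g j ^ k * h $ j)"] by simp
    also have "\<dots> = Xk (Suc k) *\<^sub>v b"
      unfolding b(2) it(7) using P Xhk b(1) by (intro assoc_mult_mat_vec[symmetric]) auto
    finally show ?case using rot[OF b(1), of "Suc k"] by simp
  qed
qed

text \<open>The starting block contains a vector whose leading p coordinates form a unit vector and
  whose remaining ones form column i of E0. The filter multiplies coordinate j by g j in each step,
  so after division by g i ^ k the leading part is unchanged while the tail is damped by at most (g
  p / g i) ^ k.\<close>

lemma subspace_iteration_error:
  fixes Xk Q R Xb Xh :: "nat \<Rightarrow> real mat"
  assumes P: "P \<in> carrier_mat n n" and ev: "\<And>j. j < n \<Longrightarrow> P *\<^sub>v col X j = g j \<cdot>\<^sub>v col X j"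
    and it: "\<And>k. Q k \<in> carrier_mat n p" "\<And>k. R k \<in> carrier_mat p p" "\<And>k. Xb k \<in> carrier_mat p p"
      "\<And>k. invertible_mat (Xb k)" "\<And>k. Xk k = Q k * R k" "\<And>k. Xh k = Q k * Xb k"
      "\<And>k. Xk (Suc k) = P * Xh k"
    and X0: "Xk 0 \<in> carrier_mat n p" "invertible_mat ((lead_cols p X)\<^sup>T * H * Xk 0)"
    and p: "p < n" and i: "i < p" and gi: "0 < g i"
    and g: "\<And>j. p \<le> j \<Longrightarrow> j < n \<Longrightarrow> 0 \<le> g j \<and> g j \<le> g p"
  defines "E0 \<equiv> (trail_cols p X)\<^sup>T * H * Xk 0 * minv p ((lead_cols p X)\<^sup>T * H * Xk 0)"
  shows "\<exists>a \<in> carrier_vec p. sqrt ((col X i - Xh k *\<^sub>v a) \<bullet> (H *\<^sub>v (col X i - Xh k *\<^sub>v a)))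
      \<le> (g p / g i) ^ k * opnorm E0"
proof -
  define Y where "Y = minv p ((lead_cols p X)\<^sup>T * H * Xk 0)"
  have lc: "(lead_cols p X)\<^sup>T \<in> carrier_mat p n" and tc: "(trail_cols p X)\<^sup>T \<in> carrier_mat (n - p) n"
    using X by (auto simp: lead_cols_def trail_cols_def)
  have N: "(lead_cols p X)\<^sup>T * H * Xk 0 \<in> carrier_mat p p" using lc H X0 by simp
  have Y: "Y \<in> carrier_mat p p" "(lead_cols p X)\<^sup>T * H * Xk 0 * Y = 1\<^sub>m p"
    unfolding Y_def by (rule minv_inverse[OF N X0(2)])+
  have E0: "E0 \<in> carrier_mat (n - p) p"
    unfolding E0_def Y_def[symmetric] using tc H X0 Y by (intro carrier_matI) auto
  \<comment> \<open>Column i of the inverse of the leading block, chosen to normalise the leading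
    coordinates to a unit vector.\<close>
  define a where "a = Y *\<^sub>v unit_vec p i"
  have a: "a \<in> carrier_vec p" using Y by (simp add: a_def)
  define w where "w = Xk 0 *\<^sub>v a"
  have w: "w \<in> carrier_vec n" using X0 a by (simp add: w_def)
  have Hw: "H *\<^sub>v w \<in> carrier_vec n" using H w by simp
  define h where "h = coords w"
  have h: "h \<in> carrier_vec n" unfolding h_def by (rule coords_carrier)
  have Xh: "X *\<^sub>v h = Xk 0 *\<^sub>v a" unfolding h_def X_coords[OF w] by (simp add: w_def)
  have expand: "C *\<^sub>v (H *\<^sub>v w) = (C * H * Xk 0 * Y) *\<^sub>v unit_vec p i" if "C \<in> carrier_mat l n" for C l
    unfolding w_def a_def using that H X0(1) Y(1)
    by (simp add: assoc_mult_mat_vec[of _ l n _ n] assoc_mult_mat_vec[of _ l n _ p]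
        assoc_mult_mat_vec[of _ l p _ p] mult_carrier_mat[of _ l n])
  have h_lead: "h $ j = (if j = i then 1 else 0)" if "j < p" for j
  proof -
    have "h $ j = ((lead_cols p X)\<^sup>T *\<^sub>v (H *\<^sub>v w)) $ j"
      unfolding h_def coords_def using lead_cols_transpose_mult_vec[OF X _ Hw that] p by simp
    then show ?thesis unfolding expand[OF lc] Y(2) using that i by simp
  qed
  have h_trail: "h $ (j + p) = (E0 *\<^sub>v unit_vec p i) $ j" if "j < n - p" for j
    unfolding h_def coords_def E0_def Y_def[symmetric] expand[OF tc, symmetric]
    using trail_cols_transpose_mult_vec[OF X Hw that] by simp
  obtain b where b: "b \<in> carrier_vec p" "X *\<^sub>v vec n (\<lambda>j. g j ^ k * h $ j) = Xh k *\<^sub>v b"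
    using filtered_start_in_ritz_space[OF P ev it h a Xh] by blast
  have Xhk: "Xh k \<in> carrier_mat n p" unfolding it(6) using it(1,3)[of k] by simp
  let ?r = "1 / g i ^ k"
  define f where "f = vec n (\<lambda>j. if j < p then 0 else - (?r * (g j ^ k * h $ j)))"
  have f: "f \<in> carrier_vec n" by (simp add: f_def)
  have "col X i - Xh k *\<^sub>v (?r \<cdot>\<^sub>v b) = X *\<^sub>v unit_vec n i - ?r \<cdot>\<^sub>v (X *\<^sub>v vec n (\<lambda>j. g j ^ k * h $ j))"
    unfolding b(2) using Xhk b(1) i p by (simp add: mult_mat_vec[of _ n p] col_X)
  also have "\<dots> = X *\<^sub>v (unit_vec n i - ?r \<cdot>\<^sub>v vec n (\<lambda>j. g j ^ k * h $ j))"
    using X by (simp add: mult_minus_distrib_mat_vec[of _ n n] mult_mat_vec[of _ n n])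
  also have "unit_vec n i - ?r \<cdot>\<^sub>v vec n (\<lambda>j. g j ^ k * h $ j) = f"
    unfolding f_def using i p gi h_lead by (intro eq_vecI) auto
  finally have diff: "col X i - Xh k *\<^sub>v (?r \<cdot>\<^sub>v b) = X *\<^sub>v f" .
  let ?q = "(g p / g i) ^ k"
  have q0: "0 \<le> ?q" using g[of p] p gi by simp
  have "f \<bullet> f = (\<Sum>j = 0..<n. (f $ j)\<^sup>2)" using f by (simp add: scalar_prod_def power2_eq_square)
  also have "\<dots> = (\<Sum>j \<in> {p..<n}. (f $ j)\<^sup>2)"
    using p by (intro sum.mono_neutral_right) (auto simp: f_def)
  also have "\<dots> = (\<Sum>j = 0..<n - p. (f $ (j + p))\<^sup>2)"
    using sum.shift_bounds_nat_ivl[of "\<lambda>j. (f $ j)\<^sup>2" 0 p "n - p"] p by simp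
  also have "\<dots> \<le> (\<Sum>j = 0..<n - p. ?q\<^sup>2 * ((E0 *\<^sub>v unit_vec p i) $ j)\<^sup>2)"
  proof (rule sum_mono)
    fix j assume "j \<in> {0..<n - p}"
    then have j: "j < n - p" by simp
    have "f $ (j + p) = - ((g (j + p) / g i) ^ k * (E0 *\<^sub>v unit_vec p i) $ j)"
      unfolding f_def h_trail[OF j, symmetric] using j by (simp add: power_divide)
    \<comment> \<open>Here both bounds 0 \<le> g (j + p) \<le> g p are used; a negative value of
      large modulus would break the comparison of even powers.\<close>
    moreover have "((g (j + p) / g i) ^ k)\<^sup>2 \<le> ?q\<^sup>2"
      using g[of "j + p"] j gi by (intro power_mono divide_right_mono) auto
    ultimately show "(f $ (j + p))\<^sup>2 \<le> ?q\<^sup>2 * ((E0 *\<^sub>v unit_vec p i) $ j)\<^sup>2"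
      by (simp add: power_mult_distrib mult_right_mono)
  qed
  also have "\<dots> = ?q\<^sup>2 * (vnorm (E0 *\<^sub>v unit_vec p i))\<^sup>2"
    unfolding vnorm_square sum_distrib_left[symmetric] using E0 by (simp add: scalar_prod_def power2_eq_square)
  also have "\<dots> \<le> ?q\<^sup>2 * (opnorm E0)\<^sup>2"
  proof (intro mult_left_mono power_mono)
    have "vnorm (unit_vec p i) = 1" using i by (simp add: vnorm_def)
    then show "vnorm (E0 *\<^sub>v unit_vec p i) \<le> opnorm E0"
      using vnorm_mult_mat_vec_le[OF E0, of "unit_vec p i"] by simp
  qed (auto simp: vnorm_nonneg)
  finally have "sqrt (f \<bullet> f) \<le> ?q * opnorm E0"
    using q0 opnorm_nonneg[of E0] by (intro real_le_lsqrt) (auto simp: power_mult_distrib)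
  then have "sqrt ((col X i - Xh k *\<^sub>v (?r \<cdot>\<^sub>v b)) \<bullet> (H *\<^sub>v (col X i - Xh k *\<^sub>v (?r \<cdot>\<^sub>v b)))) \<le> ?q * opnorm E0"
    unfolding diff X_isometry[OF f f] .
  moreover have "?r \<cdot>\<^sub>v b \<in> carrier_vec p" using b by simp
  ultimately show ?thesis by blast
qed

end

section \<open>Convergence of the Ritz quintuples\<close>

lemma orthonormal_col:
  fixes U :: "real mat"
  assumes "U \<in> carrier_mat m p" "U\<^sup>T * U = 1\<^sub>m p" "j < p"
  shows "col U j \<bullet> col U j = 1"
  using arg_cong[OF assms(2), of "\<lambda>M. M $$ (j, j)"] assms(1,3) by simp

text \<open>Everything rests on C Y = Uh D with D diagonal, stated for a general C so that it serves
  both A and B. If C Q has full column rank, then C maps no Ritz vector to zero, since the columns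
  of the invertible Xb are nonzero; hence no diagonal entry vanishes.\<close>

lemma ritz_factorization:
  fixes C :: "real mat"
  assumes C: "C \<in> carrier_mat m n" and Q: "Q \<in> carrier_mat n p"
    and Q1: "Q1 \<in> carrier_mat m p" "Q1\<^sup>T * Q1 = 1\<^sub>m p" and T: "T \<in> carrier_mat p p" "C * Q = Q1 * T"
    and Ub: "Ub \<in> carrier_mat p p" "Ub\<^sup>T * Ub = 1\<^sub>m p"
    and Xb: "Xb \<in> carrier_mat p p" "invertible_mat Xb"
    and fac: "T = Ub * mat_diag p d * minv p Xb"
  defines "Uh \<equiv> Q1 * Ub" and "Y \<equiv> Q * Xb"
  shows "Uh \<in> carrier_mat m p" "Uh\<^sup>T * Uh = 1\<^sub>m p"
    "Y\<^sup>T * (C\<^sup>T * C) * Y = mat_diag p (\<lambda>j. (d j)\<^sup>2)"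
    "\<And>j. j < p \<Longrightarrow> C *\<^sub>v col Y j = d j \<cdot>\<^sub>v col Uh j"
    "\<And>j. full_col_rank (C * Q) \<Longrightarrow> j < p \<Longrightarrow> d j \<noteq> 0"
proof -
  note inv = minv_inverse[OF Xb]
  let ?D = "mat_diag p d"
  have D: "?D \<in> carrier_mat p p" by simp
  show Uh: "Uh \<in> carrier_mat m p" unfolding Uh_def using Q1 Ub by simp
  have Y: "Y \<in> carrier_mat n p" unfolding Y_def using Q Xb by simp
  have "Uh\<^sup>T * Uh = Ub\<^sup>T * (Q1\<^sup>T * Q1) * Ub"
    unfolding Uh_def using Q1(1) Ub(1)
    by (simp add: transpose_mult[of _ m p _ p] assoc_mult_mat[of _ p p _ m _ p]
        assoc_mult_mat[of _ p m _ p _ p] assoc_mult_mat[of _ p p _ p _ p])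
  then show UU: "Uh\<^sup>T * Uh = 1\<^sub>m p" unfolding Q1(2) using Ub by simp
  have TX: "T * Xb = Ub * ?D"
  proof -
    have "T * Xb = Ub * ?D * (minv p Xb * Xb)"
      unfolding fac using Ub(1) by (intro assoc_mult_mat[OF _ inv(1) Xb(1), of _ p]) (simp add: mult_carrier_mat[of _ p p])
    then show ?thesis unfolding inv(3) using Ub D by (simp add: right_mult_one_mat[of _ p p])
  qed
  have "C * Y = C * Q * Xb" unfolding Y_def using C Q Xb by (intro assoc_mult_mat[symmetric]) auto
  also have "\<dots> = Q1 * (T * Xb)" unfolding T(2) using Q1 T Xb by (intro assoc_mult_mat) auto
  also have "\<dots> = Uh * ?D" unfolding TX Uh_def by (rule assoc_mult_mat[OF Q1(1) Ub(1) D, symmetric])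
  finally have CY: "C * Y = Uh * ?D" .
  have "Y\<^sup>T * (C\<^sup>T * C) * Y = (C * Y)\<^sup>T * (C * Y)"
    using C Y by (simp add: transpose_mult[of _ m n _ p] assoc_mult_mat[of _ p n _ m _ p]
        assoc_mult_mat[of _ p n _ n _ p] assoc_mult_mat[of _ n m _ n _ p])
  also have "\<dots> = ?D * (Uh\<^sup>T * Uh) * ?D"
    unfolding CY using Uh D
    by (simp add: transpose_mult[of _ m p _ p] transpose_mat_diag assoc_mult_mat[of _ p p _ m _ p]
        assoc_mult_mat[of _ p m _ p _ p] assoc_mult_mat[of _ p p _ p _ p])
  also have "\<dots> = mat_diag p (\<lambda>j. (d j)\<^sup>2)"
    unfolding UU using D by (simp add: right_mult_one_mat[of _ p p] power2_eq_square)
  finally show "Y\<^sup>T * (C\<^sup>T * C) * Y = mat_diag p (\<lambda>j. (d j)\<^sup>2)" .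
  show col: "C *\<^sub>v col Y j = d j \<cdot>\<^sub>v col Uh j" if j: "j < p" for j
  proof -
    have "C *\<^sub>v col Y j = col (Uh * ?D) j" unfolding CY[symmetric] col_mult2[OF C Y j] ..
    also have "\<dots> = d j \<cdot>\<^sub>v col Uh j"
      unfolding mat_diag_mult_right[OF Uh] using j Uh by (intro eq_vecI) auto
    finally show ?thesis .
  qed
  show "d j \<noteq> 0" if rank: "full_col_rank (C * Q)" and j: "j < p" for j
  proof
    assume "d j = 0"
    then have "C *\<^sub>v col Y j = 0\<^sub>v m" using col[OF j] Uh by (intro eq_vecI) auto
    moreover have "col Y j = Q *\<^sub>v col Xb j" unfolding Y_def by (rule col_mult2[OF Q Xb(1) j])
    moreover have x: "col Xb j \<in> carrier_vec p" using Xb(1) by (intro carrier_vecI) simp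
    ultimately have "(C * Q) *\<^sub>v col Xb j = 0\<^sub>v m"
      unfolding assoc_mult_mat_vec[OF C Q x] by simp
    moreover have "dim_row (C * Q) = m" "dim_col (C * Q) = p" using C Q by auto
    ultimately have "col Xb j = 0\<^sub>v p" using rank x unfolding full_col_rank_def by metis
    moreover have "col (minv p Xb * Xb) j = minv p Xb *\<^sub>v col Xb j" by (rule col_mult2[OF inv(1) Xb(1) j])
    ultimately have "col (1\<^sub>m p) j = (0\<^sub>v p :: real vec)"
      unfolding inv(3) using mult_mat_zero_vec[OF inv(1)] by simp
    then have "col (1\<^sub>m p) j $ j = (0\<^sub>v p :: real vec) $ j" by simp
    then show False using j by simp
  qed
qed

text \<open>The first bound is conditional on positive gaps: with a zero gap the convention x / 0 =
  0 would turn the factor into 1 instead of infinity. The other three are conditional on 0 < c i <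
  1, the nontrivial case in which u i and v i are specified.\<close>

theorem theorem4p2:
  fixes A B U V X :: "real mat"
    and m1 m2 n p d r ngv :: nat
    and cmin cmax :: real
    and c s :: "nat \<Rightarrow> real"
    and u v :: "nat \<Rightarrow> real vec"
    and Xk Q R Q1 Ab Q2 Bb Ub Vb Xb Xh Uh Vh :: "nat \<Rightarrow> real mat"
    and ch sh :: "nat \<Rightarrow> nat \<Rightarrow> real"
    and H S Pf SA SB E0 :: "real mat"
    and \<gamma> :: "nat \<Rightarrow> real"
    and \<beta> :: "nat \<Rightarrow> real"
  defines "H \<equiv> A\<^sup>T * A + B\<^sup>T * B"
    and "S \<equiv> minv n H * (A\<^sup>T * A - B\<^sup>T * B)"
    and "Pf \<equiv> filter_mat n cmin cmax d S"
    and "\<gamma> \<equiv> (\<lambda>i. psi cmin cmax d (lmap (c i)))"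
    and "SA \<equiv> U\<^sup>T * A * X"
    and "SB \<equiv> V\<^sup>T * B * X"
    and "E0 \<equiv> (trail_cols p X)\<^sup>T * H * Xk 0 * minv p ((lead_cols p X)\<^sup>T * H * Xk 0)"
    and "\<beta> \<equiv> (\<lambda>k. let Pk = orth_proj n (msqrt n H * Xh k); Hmh = minv n (msqrt n H) in
                   opnorm (Pk * Hmh * A\<^sup>T * A * Hmh * (1\<^sub>m n - Pk)))"
  assumes dimA: "A \<in> carrier_mat m1 n" and dimB: "B \<in> carrier_mat m2 n"
    and mn: "m1 + m2 \<ge> n"
    and rankAB: "full_col_rank (A @\<^sub>r B)"
    \<comment> \<open>the GSVD of (A,B); column i of X is x_(i+1) (0-based indexing)\<close>
    and U_orth: "U \<in> carrier_mat m1 m1" "U\<^sup>T * U = 1\<^sub>m m1"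
    and V_orth: "V \<in> carrier_mat m2 m2" "V\<^sup>T * V = 1\<^sub>m m2"
    and X_nonsing: "X \<in> carrier_mat n n" "invertible_mat X"
    and X_Horth: "X\<^sup>T * H * X = 1\<^sub>m n"
    and SA_diag: "SA\<^sup>T * SA = mat_diag n (\<lambda>i. (c i)\<^sup>2)"
    and SB_diag: "SB\<^sup>T * SB = mat_diag n (\<lambda>i. (s i)\<^sup>2)"
    and cs: "\<forall>i<n. c i \<ge> 0 \<and> s i \<ge> 0 \<and> (c i)\<^sup>2 + (s i)\<^sup>2 = 1"
    and uv: "\<forall>i<n. 0 < c i \<and> c i < 1 \<longrightarrow>
               u i \<in> set (cols U) \<and> v i \<in> set (cols V) \<and>
               A *\<^sub>v col X i = c i \<cdot>\<^sub>v u i \<and> B *\<^sub>v col X i = s i \<cdot>\<^sub>v v i"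
    \<comment> \<open>the search interval and the indexing of the generalized singular values\<close>
    and cint: "0 \<le> cmin" "cmin \<le> cmax" "cmax \<le> 1"
    and idx: "r \<le> ngv" "ngv \<le> p" "0 < p" "p < n"
    and grp1: "\<forall>i<r. cmin < c i \<and> c i < cmax"
    and grp2: "\<forall>i. r \<le> i \<and> i < ngv \<longrightarrow> c i = cmin \<or> c i = cmax"
    and grp3: "\<forall>i. ngv \<le> i \<and> i < n \<longrightarrow> c i < cmin \<or> cmax < c i"
    and dec1: "\<forall>i j. i \<le> j \<and> j < r \<longrightarrow> \<gamma> j \<le> \<gamma> i"
    and dec2: "\<forall>i j. r \<le> i \<and> i \<le> j \<and> j < ngv \<longrightarrow> \<gamma> j \<le> \<gamma> i"
    and dec3: "\<forall>i j. ngv \<le> i \<and> i \<le> j \<and> j < n \<longrightarrow> \<gamma> j \<le> \<gamma> i"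
    and simple: "\<forall>i<n. \<forall>j<n. i \<noteq> j \<and> cmin \<le> c i \<and> c i \<le> cmax \<longrightarrow> c i \<noteq> c j"
    and gap: "\<gamma> (p - 1) > \<gamma> p"
    \<comment> \<open>the starting block\<close>
    and X0: "Xk 0 \<in> carrier_mat n p" "full_col_rank (Xk 0)"
    and X0_nonsing: "invertible_mat ((lead_cols p X)\<^sup>T * H * Xk 0)"
    \<comment> \<open>the iteration\<close>
    and QR: "\<forall>k. Q k \<in> carrier_mat n p \<and> (Q k)\<^sup>T * Q k = 1\<^sub>m p \<and>
               R k \<in> carrier_mat p p \<and> upper_triangular (R k) \<and> Xk k = Q k * R k"
    and QRA: "\<forall>k. Q1 k \<in> carrier_mat m1 p \<and> (Q1 k)\<^sup>T * Q1 k = 1\<^sub>m p \<and>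
               Ab k \<in> carrier_mat p p \<and> upper_triangular (Ab k) \<and> A * Q k = Q1 k * Ab k \<and>
               full_col_rank (A * Q k)"
    and QRB: "\<forall>k. Q2 k \<in> carrier_mat m2 p \<and> (Q2 k)\<^sup>T * Q2 k = 1\<^sub>m p \<and>
               Bb k \<in> carrier_mat p p \<and> upper_triangular (Bb k) \<and> B * Q k = Q2 k * Bb k \<and>
               full_col_rank (B * Q k)"
    and GSVDk: "\<forall>k. Ub k \<in> carrier_mat p p \<and> (Ub k)\<^sup>T * Ub k = 1\<^sub>m p \<and>
               Vb k \<in> carrier_mat p p \<and> (Vb k)\<^sup>T * Vb k = 1\<^sub>m p \<and>
               Xb k \<in> carrier_mat p p \<and> invertible_mat (Xb k) \<and>
               Ab k = Ub k * mat_diag p (ch k) * minv p (Xb k) \<and>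
               Bb k = Vb k * mat_diag p (sh k) * minv p (Xb k) \<and>
               (\<forall>i<p. ch k i \<ge> 0 \<and> sh k i \<ge> 0 \<and> (ch k i)\<^sup>2 + (sh k i)\<^sup>2 = 1)"
    and ritz: "\<forall>k. Xh k = Q k * Xb k \<and> Uh k = Q1 k * Ub k \<and> Vh k = Q2 k * Vb k"
    and label: "\<forall>k. \<forall>i<ngv. \<forall>j<ngv. c i < c j \<longrightarrow> ch k i \<le> ch k j"
    and next_it: "\<forall>k. Xk (Suc k) = Pf * Xh k"
  shows "\<forall>k. \<forall>i<ngv.
     ((\<forall>g \<in> {\<bar>(c i)\<^sup>2 - (ch k j)\<^sup>2\<bar> | j. j < p \<and> j \<noteq> i}. g > 0) \<longrightarrow>
        sinH H (col (Xh k) i) (col X i)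
          \<le> gap_factor (\<beta> k) {\<bar>(c i)\<^sup>2 - (ch k j)\<^sup>2\<bar> | j. j < p \<and> j \<noteq> i}
             * (\<gamma> p / \<gamma> i) ^ k * opnorm E0)
   \<and> (0 < c i \<and> c i < 1 \<longrightarrow>
        sin_angle (col (Uh k) i) (u i) \<le> opnorm SA / ch k i * sinH H (col (Xh k) i) (col X i)
      \<and> sin_angle (col (Vh k) i) (v i) \<le> opnorm SB / sh k i * sinH H (col (Xh k) i) (col X i)
      \<and> chordal ((ch k i / sh k i)\<^sup>2) ((c i / s i)\<^sup>2)
          \<le> 2 * (sinH H (col (Xh k) i) (col X i))\<^sup>2)"
proof -
  have XAX: "X\<^sup>T * (A\<^sup>T * A) * X = mat_diag n (\<lambda>i. (c i)\<^sup>2)"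
  proof -
    have UU: "U * U\<^sup>T = 1\<^sub>m m1" using mat_mult_left_right_inverse[of "U\<^sup>T" m1 U] U_orth by simp
    have AX: "A * X \<in> carrier_mat m1 n" using dimA X_nonsing by simp
    have SA: "SA = U\<^sup>T * (A * X)"
      unfolding SA_def using U_orth(1) dimA X_nonsing(1) by (intro assoc_mult_mat) auto
    have "SA\<^sup>T * SA = (A * X)\<^sup>T * (U * U\<^sup>T) * (A * X)"
      unfolding SA using U_orth(1) AX
      by (simp add: transpose_mult[of _ m1 m1 _ n] assoc_mult_mat[of _ n m1 _ m1 _ n]
          assoc_mult_mat[of _ n m1 _ m1 _ m1] assoc_mult_mat[of _ m1 m1 _ m1 _ n])
    also have "\<dots> = (A * X)\<^sup>T * (A * X)" unfolding UU using AX by (simp add: right_mult_one_mat[of _ n m1])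
    also have "\<dots> = X\<^sup>T * (A\<^sup>T * A) * X"
      using dimA X_nonsing(1)
      by (simp add: transpose_mult[of _ m1 n _ n] assoc_mult_mat[of _ n n _ m1 _ n]
          assoc_mult_mat[of _ n n _ n _ n] assoc_mult_mat[of _ n m1 _ n _ n])
    finally show ?thesis using SA_diag by simp
  qed
  interpret g: gsvd_pair A B X H m1 m2 n c
    by standard (use dimA dimB X_nonsing X_Horth XAX H_def in auto)
  have Sc: "S \<in> carrier_mat n n"
    unfolding S_def g.minv_H using dimA dimB X_nonsing(1) by (intro carrier_matI) auto
  have Sev: "S *\<^sub>v col X j = lmap (c j) \<cdot>\<^sub>v col X j" if "j < n" for j
    unfolding S_def by (rule g.shift_eigenvector[OF that])
  note filt = filter_mat_eigenvector[OF Sc g.col_X_carrier Sev, of _ cmin cmax d, folded Pf_def]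
  have Pc: "Pf \<in> carrier_mat n n" using filt(1)[of 0] idx by simp
  have Pev: "Pf *\<^sub>v col X j = \<gamma> j \<cdot>\<^sub>v col X j" if "j < n" for j
    unfolding \<gamma>_def by (rule filt(2)[OF that])
  have c01: "0 \<le> c j" "c j \<le> 1" if "j < n" for j
  proof -
    have "(c j)\<^sup>2 \<le> 1" using cs that zero_le_power2[of "s j"] by (metis le_add_same_cancel1)
    then show "0 \<le> c j" "c j \<le> 1" using cs that by (auto simp: power2_le_iff_abs_le abs_square_le_1)
  qed
  \<comment> \<open>On a degenerate interval every \<open>eta\<close> vanishes, so the filter is
    identically zero and the strict gap at p is impossible. Strict positivity of the filter relies
    on this.\<close>
  have "cmin \<noteq> cmax"
  proof
    assume "cmin = cmax"
    then have "eta cmin cmax j = 0" for j by (simp add: eta_def Let_def)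
    then have "\<gamma> j = 0" for j unfolding \<gamma>_def psi_def by simp
    then show False using gap by simp
  qed
  then have cmm: "cmin < cmax" using cint by simp
  have \<gamma>pos: "0 < \<gamma> j" if "j < n" for j
    unfolding \<gamma>_def
  proof (rule psi_pos[OF cint(1) cmm cint(3)])
    show "- 1 \<le> lmap (c j)" "lmap (c j) \<le> 1"
      using c01[OF that] by (auto simp: lmap_def power_le_one)
  qed
  show ?thesis
  proof (intro allI impI)
    fix k i assume i: "i < ngv"
    then have ip: "i < p" and i_n: "i < n" using idx by auto
    note GA = QRA[rule_format, of k] and GB = QRB[rule_format, of k] and GG = GSVDk[rule_format, of k]
      and GQ = QR[rule_format, of k]
    have Uh: "Uh k = Q1 k * Ub k" and Vh: "Vh k = Q2 k * Vb k" and Xh: "Xh k = Q k * Xb k"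
      using ritz by auto
    have Qk: "Q k \<in> carrier_mat n p" and Xbk: "Xb k \<in> carrier_mat p p" "invertible_mat (Xb k)"
      using GQ GG by auto
    have facA: "Ab k = Ub k * mat_diag p (ch k) * minv p (Xb k)"
      and facB: "Bb k = Vb k * mat_diag p (sh k) * minv p (Xb k)" using GG by auto
    have rA: "Q1 k \<in> carrier_mat m1 p" "(Q1 k)\<^sup>T * Q1 k = 1\<^sub>m p" "Ab k \<in> carrier_mat p p"
        "A * Q k = Q1 k * Ab k" "full_col_rank (A * Q k)" "Ub k \<in> carrier_mat p p" "(Ub k)\<^sup>T * Ub k = 1\<^sub>m p"
      using GA GG by auto
    have rB: "Q2 k \<in> carrier_mat m2 p" "(Q2 k)\<^sup>T * Q2 k = 1\<^sub>m p" "Bb k \<in> carrier_mat p p"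
        "B * Q k = Q2 k * Bb k" "full_col_rank (B * Q k)" "Vb k \<in> carrier_mat p p" "(Vb k)\<^sup>T * Vb k = 1\<^sub>m p"
      using GB GG by auto
    note FA = ritz_factorization[OF dimA Qk rA(1-4,6,7) Xbk facA, folded Uh Xh]
    note FB = ritz_factorization[OF dimB Qk rB(1-4,6,7) Xbk facB, folded Vh Xh]
    have chsh: "(ch k j)\<^sup>2 + (sh k j)\<^sup>2 = 1" "0 \<le> ch k j" "0 \<le> sh k j" if "j < p" for j
      using GG that by auto
    have Yc: "Xh k \<in> carrier_mat n p" unfolding Xh using Qk Xbk by simp
    \<comment> \<open>The Gram matrices of the Ritz vectors under A and B are diagonal with entries
      ch^2 and sh^2, which add up to 1.\<close>
    have YHY: "(Xh k)\<^sup>T * H * Xh k = 1\<^sub>m p"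
    proof -
      have AA: "A\<^sup>T * A \<in> carrier_mat n n" and BB: "B\<^sup>T * B \<in> carrier_mat n n" using dimA dimB by auto
      have YT: "(Xh k)\<^sup>T \<in> carrier_mat p n" using Yc by simp
      have "(Xh k)\<^sup>T * H * Xh k = (Xh k)\<^sup>T * (A\<^sup>T * A) * Xh k + (Xh k)\<^sup>T * (B\<^sup>T * B) * Xh k"
        unfolding H_def mult_add_distrib_mat[OF YT AA BB]
        by (rule add_mult_distrib_mat[OF mult_carrier_mat[OF YT AA] mult_carrier_mat[OF YT BB] Yc])
      also have "\<dots> = 1\<^sub>m p"
        unfolding FA(3) FB(3) using chsh by (intro eq_matI) (auto simp: mat_diag_def)
      finally show ?thesis .
    qed
    let ?y = "col (Xh k) i" and ?x = "col X i"
    have yc: "?y \<in> carrier_vec n" using Yc by (intro carrier_vecI) simp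
    have colY: "?y = Xh k *\<^sub>v unit_vec p i" using Yc ip by (intro eq_vecI) auto
    have yy: "?y \<bullet> (H *\<^sub>v ?y) = 1"
      unfolding colY using g.ritz_block_isometry[OF Yc YHY, of "unit_vec p i" "unit_vec p i"] ip by simp
    \<comment> \<open>Full column rank of A Q and B Q keeps the denominators of the later bounds
      away from zero.\<close>
    have chpos: "0 < ch k i" and shpos: "0 < sh k i"
      using FA(5)[OF rA(5) ip] FB(5)[OF rB(5) ip] chsh[OF ip] by auto
    have part1: "sinH H ?y ?x \<le> gap_factor (\<beta> k) {\<bar>(c i)\<^sup>2 - (ch k j)\<^sup>2\<bar> | j. j < p \<and> j \<noteq> i}
        * (\<gamma> p / \<gamma> i) ^ k * opnorm E0"
      if G: "\<forall>e \<in> {\<bar>(c i)\<^sup>2 - (ch k j)\<^sup>2\<bar> | j. j < p \<and> j \<noteq> i}. 0 < e"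
    proof -
      \<comment> \<open>Because ngv \<le> p, all indices from p on lie in the third group, where the
        values decrease; positivity of the filter supplies the lower bound.\<close>
      have \<gamma>dec: "0 \<le> \<gamma> j \<and> \<gamma> j \<le> \<gamma> p" if "p \<le> j" "j < n" for j
        using \<gamma>pos[of j] dec3 idx that by (auto simp: less_imp_le)
      obtain a where a: "a \<in> carrier_vec p"
          "sqrt ((?x - Xh k *\<^sub>v a) \<bullet> (H *\<^sub>v (?x - Xh k *\<^sub>v a))) \<le> (\<gamma> p / \<gamma> i) ^ k * opnorm E0"
      proof -
        have "\<exists>a \<in> carrier_vec p. sqrt ((?x - Xh k *\<^sub>v a) \<bullet> (H *\<^sub>v (?x - Xh k *\<^sub>v a)))
            \<le> (\<gamma> p / \<gamma> i) ^ k * opnorm E0"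
          unfolding E0_def
          by (rule g.subspace_iteration_error[where P = Pf and Q = Q and R = R and Xb = Xb])
            (use Pc Pev QR GSVDk ritz next_it X0 X0_nonsing idx ip \<gamma>pos[OF i_n] \<gamma>dec in auto)
        then show thesis using that by blast
      qed
      have "sinH H ?y ?x \<le> gap_factor (\<beta> k) {\<bar>(c i)\<^sup>2 - (ch k j)\<^sup>2\<bar> | j. j < p \<and> j \<noteq> i}
          * sqrt ((?x - Xh k *\<^sub>v a) \<bullet> (H *\<^sub>v (?x - Xh k *\<^sub>v a)))"
        unfolding \<beta>_def Let_def by (rule g.sinH_ritz_le[OF Yc YHY FA(3) i_n ip a(1) G])
      also have "\<dots> \<le> gap_factor (\<beta> k) {\<bar>(c i)\<^sup>2 - (ch k j)\<^sup>2\<bar> | j. j < p \<and> j \<noteq> i}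
          * ((\<gamma> p / \<gamma> i) ^ k * opnorm E0)"
        by (intro mult_left_mono a(2)) (simp add: gap_factor_def)
      finally show ?thesis by (simp only: mult.assoc)
    qed
    have part2: "sin_angle (col (Uh k) i) (u i) \<le> opnorm SA / ch k i * sinH H ?y ?x
      \<and> sin_angle (col (Vh k) i) (v i) \<le> opnorm SB / sh k i * sinH H ?y ?x
      \<and> chordal ((ch k i / sh k i)\<^sup>2) ((c i / s i)\<^sup>2) \<le> 2 * (sinH H ?y ?x)\<^sup>2"
      if ci: "0 < c i \<and> c i < 1"
    proof (intro conjI)
      have uvi: "u i \<in> set (cols U)" "v i \<in> set (cols V)" "A *\<^sub>v ?x = c i \<cdot>\<^sub>v u i" "B *\<^sub>v ?x = s i \<cdot>\<^sub>v v i"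
        using uv i_n ci by auto
      have u: "u i \<in> carrier_vec m1" "u i \<bullet> u i = 1"
        using uvi(1) U_orth orthonormal_col[OF U_orth] by (auto simp: cols_def intro: carrier_vecI)
      have v: "v i \<in> carrier_vec m2" "v i \<bullet> v i = 1"
        using uvi(2) V_orth orthonormal_col[OF V_orth] by (auto simp: cols_def intro: carrier_vecI)
      have uh: "col (Uh k) i \<in> carrier_vec m1" and vh: "col (Vh k) i \<in> carrier_vec m2"
        using FA(1) FB(1) by (auto intro: carrier_vecI)
      show "sin_angle (col (Uh k) i) (u i) \<le> opnorm SA / ch k i * sinH H ?y ?x"
        unfolding SA_def
        by (rule g.sin_angle_image_le[OF i_n yc yy dimA g.vnorm_mult_le_opnorm[OF dimA U_orth]
              uh orthonormal_col[OF FA(1,2) ip] u FA(4)[OF ip] uvi(3) chpos])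
      show "sin_angle (col (Vh k) i) (v i) \<le> opnorm SB / sh k i * sinH H ?y ?x"
        unfolding SB_def
        by (rule g.sin_angle_image_le[OF i_n yc yy dimB g.vnorm_mult_le_opnorm[OF dimB V_orth]
              vh orthonormal_col[OF FB(1,2) ip] v FB(4)[OF ip] uvi(4) shpos])
      have csi: "0 \<le> s i" "(c i)\<^sup>2 + (s i)\<^sup>2 = 1" using cs i_n by auto
      have "(c i)\<^sup>2 < 1" using ci by (simp add: abs_square_less_1)
      then have si: "0 < s i" using csi by (cases "s i = 0") auto
      have "vnorm (col (Uh k) i) = 1" unfolding vnorm_def orthonormal_col[OF FA(1,2) ip] by simp
      then have "(vnorm (A *\<^sub>v ?y))\<^sup>2 = (ch k i)\<^sup>2" unfolding FA(4)[OF ip] vnorm_smult by simp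
      then have "\<bar>(ch k i)\<^sup>2 - (c i)\<^sup>2\<bar> \<le> (sinH H ?y ?x)\<^sup>2"
        using g.rayleigh_quotient_error[OF i_n yc yy] \<open>(c i)\<^sup>2 < 1\<close> by simp
      then have "2 * \<bar>(ch k i)\<^sup>2 - (c i)\<^sup>2\<bar> \<le> 2 * (sinH H ?y ?x)\<^sup>2" by (rule mult_left_mono) simp
      with chordal_square_ratio_le[OF shpos si chsh(1)[OF ip] csi(2)]
      show "chordal ((ch k i / sh k i)\<^sup>2) ((c i / s i)\<^sup>2) \<le> 2 * (sinH H ?y ?x)\<^sup>2"
        by (rule order_trans)
    qed
    show "((\<forall>g \<in> {\<bar>(c i)\<^sup>2 - (ch k j)\<^sup>2\<bar> | j. j < p \<and> j \<noteq> i}. g > 0) \<longrightarrow>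
        sinH H ?y ?x
          \<le> gap_factor (\<beta> k) {\<bar>(c i)\<^sup>2 - (ch k j)\<^sup>2\<bar> | j. j < p \<and> j \<noteq> i}
             * (\<gamma> p / \<gamma> i) ^ k * opnorm E0)
   \<and> (0 < c i \<and> c i < 1 \<longrightarrow>
        sin_angle (col (Uh k) i) (u i) \<le> opnorm SA / ch k i * sinH H ?y ?x
      \<and> sin_angle (col (Vh k) i) (v i) \<le> opnorm SB / sh k i * sinH H ?y ?x
      \<and> chordal ((ch k i / sh k i)\<^sup>2) ((c i / s i)\<^sup>2)
          \<le> 2 * (sinH H ?y ?x)\<^sup>2)"
      using part1 part2 by blast
  qed
qed

end
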